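(* Let $L,H$ be functional causal models in a Markov category $\mathcal C$ with endogenous variables $V_L,V_H$, let $(\pi,\tau)$ be a variable alignment from $V_L$ to $V_H$, and let $Q\subseteq\mathrm{CF}^{c}(V_H)$ be a collection of concrete counterfactual queries (with types $V_H$). Then $L,H$ satisfy $Q$-$\tau$ consistency if and only if the data determines an upward abstraction $(\pi,\tau,\omega)\colon(\mathrm{CF}^{c}(V_L),L)\to(Q,H)$ via $$\omega\big([\pi(Y_1)|_{x_1},\dots,\pi(Y_m)|_{x_m}]\big):=[Y_1|_{\tau\circ x_1},\dots,Y_m|_{\tau\circ x_m}]$$ for all queries $[Y_1|_{\tau\circ x_1},\dots,Y_m|_{\tau\circ x_m}]$ in $Q$ (with $X_j,Y_j\subseteq V_H$ and $x_j$ a sharp state of $\pi(X_j)$).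
   Context: **Categories.** A Markov category is a symmetric monoidal category with terminal unit $I$ in which each object has a commutative comonoid structure (copy, discard) compatible with $\otimes$. Morphisms are called channels; $f$ is deterministic if $\mathrm{copy}\circ f=(f\otimes f)\circ\mathrm{copy}$; a sharp state of $A$ is a deterministic morphism $I\to A$. **Functional causal models (FCMs).** An FCM $M$ in $\mathcal C$ consists of a finite acyclic directed graph on variables $V\cup U$ with $V=\{X_1,\dots,X_n\}$ (endogenous) and $U=\{U_1,\dots,U_n\}$ (exogenous), where each $U_i$ has no parents and each $X_i$ has parents $\mathrm{Pa}'(X_i)\cup\{U_i\}$ with $\mathrm{Pa}'(X_i)\subseteq V$; an object of $\mathcal C$ for each variable; a state $\lambda_i\colon I\to U_i$ for each $i$; and a deterministic channel $f_i\colon\mathrm{Pa}'(X_i)\otimes U_i\to X_i$ for each $i$. It has no inputs, and outputs $V$. A set of variables is also used for the list of its elements (lists of distinct variables considered up to permutation) and for the tensor of the corresponding objects. Let $\lambda=\bigotimes_i\lambda_i\colon I\to U$. Let $F$ be the deterministic part of $M$: the causal model with inputs $U$ and mechanisms $f_i$. For $X,Y\subseteq V$ let $F_{\mathrm{Do}(X)}^{Y}\colon U\otimes X\to Y$ be the channel obtained by deleting the mechanisms $f_i$ of the variables in $X$, making $X$ into inputs, wiring the remaining mechanisms together with copy maps, and outputting (copies of) the variables in $Y$, discarding everything else. **Concrete counterfactual queries.** The signature $\mathrm{CF}^{c}(V)$ has types $V$ and, for all subsets $X_j,Y_j\subseteq V$ and sharp states $x_j$ of $X_j$ ($j=1,\dots,m$),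 a query $[Y_1|_{x_1},\dots,Y_m|_{x_m}]$ with no inputs and outputs $Y_1,\dots,Y_m$, modelled by an FCM $M$ as the state $$[\![\,[Y_1|_{x_1},\dots,Y_m|_{x_m}]\,]\!]_M=\big(F_{\mathrm{Do}(X_1)}^{Y_1}\otimes\dots\otimes F_{\mathrm{Do}(X_m)}^{Y_m}\big)\circ\big((\mathrm{copy}^{(m)}_U\circ\lambda)\otimes x_1\otimes\dots\otimes x_m\big),$$ with $\mathrm{copy}^{(m)}_U\colon U\to U^{\otimes m}$ the $m$-fold copy, the $j$-th copy of $U$ together with $x_j$ being fed into the $j$-th factor. **Variable alignment** $(\pi,\tau)$ from $V_L$ to $V_H$: pairwise disjoint subsets $\pi(X)\subseteq V_L$, $X\in V_H$ (with $\pi(S)=\bigcup_{X\in S}\pi(X)$), and epic deterministic channels $\tau_X\colon\pi(X)\to X$ (with $\tau_S=\bigotimes_{X\in S}\tau_X$, often written $\tau$; all tensor products of the $\tau_X$ are also required to be epic). **$Q$-$\tau$ consistency:** for all $X_j,Y_j\subseteq V_H$ and sharp states $x_j$ of $\pi(X_j)$ such that $[Y_1|_{\tau\circ x_1},\dots,Y_m|_{\tau\circ x_m}]\in Q$, $$(\tau_{Y_1}\otimes\dots\otimes\tau_{Y_m})\circ[\![\,[\pi(Y_1)|_{x_1},\dots,\pi(Y_m)|_{x_m}]\,]\!]_L=[\![\,[Y_1|_{\tau\circ x_1},\dots,Y_m|_{\tau\circ x_m}]\,]\!]_H.$$ **Upward abstraction** $(\pi,\tau,\omega)\colon(Q_L,L)\to(Q_H,H)$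 between query signatures with models: for each type $X$ of $Q_H$, a list $\pi(X)$ of types of $Q_L$ and an epic deterministic channel $\tau_X\colon[\![\pi(X)]\!]_L\to[\![X]\!]_H$ (extended to lists by concatenation and tensor product, all such products being required to be epic); and a partial surjective map $\omega$ from queries of $Q_L$ to queries of $Q_H$ such that whenever $\omega(q_L)=q_H\colon A\to B$ is defined, $q_L$ has type $\pi(A)\to\pi(B)$ and $\tau_B\circ[\![q_L]\!]_L=[\![q_H]\!]_H\circ\tau_A$.
   Formalization: Assumes every query in Q has the form [Y_j|τ∘x_j] with x_j a sharp state of π(X_j), and that distinct variable lists occurring in Q have distinct images under π (automatic if all π(X) are nonempty); otherwise ω may fail to be surjective or single-valued. *)

theory Defs
  imports Main
begin

section \<open>Markov categories\<close>

text \<open>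
  Nothing is assumed strict: the associator and unitors, with their inverses, are part of the data.
  The associator goes from \<open>(a \<otimes> b) \<otimes> c\<close> to \<open>a \<otimes> (b \<otimes> c)\<close>.
\<close>

record ('o, 'm) markov_cat =
  Ob :: "'o set"
  Ar :: "'m set"
  Dom :: "'m \<Rightarrow> 'o"
  Cod :: "'m \<Rightarrow> 'o"
  Ident :: "'o \<Rightarrow> 'm"
  Comp :: "'m \<Rightarrow> 'm \<Rightarrow> 'm"  (infixr \<open>\<cdot>\<index>\<close> 55)
  Tob :: "'o \<Rightarrow> 'o \<Rightarrow> 'o"  (infixr \<open>\<oplus>\<index>\<close> 70)
  Tar :: "'m \<Rightarrow> 'm \<Rightarrow> 'm"  (infixr \<open>\<otimes>\<index>\<close> 70)
  Unit :: "'o"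
  Assoc :: "'o \<Rightarrow> 'o \<Rightarrow> 'o \<Rightarrow> 'm"
  AssocI :: "'o \<Rightarrow> 'o \<Rightarrow> 'o \<Rightarrow> 'm"
  Lun :: "'o \<Rightarrow> 'm"
  LunI :: "'o \<Rightarrow> 'm"
  Run :: "'o \<Rightarrow> 'm"
  RunI :: "'o \<Rightarrow> 'm"
  Swap :: "'o \<Rightarrow> 'o \<Rightarrow> 'm"
  Copy :: "'o \<Rightarrow> 'm"
  Del :: "'o \<Rightarrow> 'm"

text \<open>\<open>\<oplus>\<close> is the monoidal product on objects, \<open>\<otimes>\<close> the one on morphisms.\<close>

definition hom :: "('o, 'm, 'z) markov_cat_scheme \<Rightarrow> 'o \<Rightarrow> 'o \<Rightarrow> 'm set" where
  "hom C a b = {f \<in> Ar C. Dom C f = a \<and> Cod C f = b}"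

locale category =
  fixes C :: "('o, 'm, 'z) markov_cat_scheme" (structure)
  assumes dom_cod: "f \<in> Ar C \<Longrightarrow> Dom C f \<in> Ob C \<and> Cod C f \<in> Ob C"
    and ident_hom: "a \<in> Ob C \<Longrightarrow> Ident C a \<in> hom C a a"
    and comp_hom: "\<lbrakk>f \<in> hom C a b; g \<in> hom C b c\<rbrakk> \<Longrightarrow> g \<cdot> f \<in> hom C a c"
    and comp_assoc: "\<lbrakk>f \<in> hom C a b; g \<in> hom C b c; h \<in> hom C c d\<rbrakk> \<Longrightarrow> (h \<cdot> g) \<cdot> f = h \<cdot> (g \<cdot> f)"
    and ident_left: "f \<in> hom C a b \<Longrightarrow> Ident C b \<cdot> f = f"
    and ident_right: "f \<in> hom C a b \<Longrightarrow> f \<cdot> Ident C a = f"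

locale monoidal_category = category +
  assumes unit_ob: "Unit C \<in> Ob C"
    and tensor_ob: "\<lbrakk>a \<in> Ob C; b \<in> Ob C\<rbrakk> \<Longrightarrow> a \<oplus> b \<in> Ob C"
    and tensor_hom: "\<lbrakk>f \<in> hom C a b; g \<in> hom C c d\<rbrakk> \<Longrightarrow> f \<otimes> g \<in> hom C (a \<oplus> c) (b \<oplus> d)"
    and tensor_ident: "\<lbrakk>a \<in> Ob C; b \<in> Ob C\<rbrakk> \<Longrightarrow> Ident C a \<otimes> Ident C b = Ident C (a \<oplus> b)"
    and tensor_comp: "\<lbrakk>f \<in> hom C a b; g \<in> hom C b c; f' \<in> hom C a' b'; g' \<in> hom C b' c'\<rbrakk>
      \<Longrightarrow> (g \<cdot> f) \<otimes> (g' \<cdot> f') = (g \<otimes> g') \<cdot> (f \<otimes> f')"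
    and assoc_hom: "\<lbrakk>a \<in> Ob C; b \<in> Ob C; c \<in> Ob C\<rbrakk>
      \<Longrightarrow> Assoc C a b c \<in> hom C ((a \<oplus> b) \<oplus> c) (a \<oplus> (b \<oplus> c))"
    and assocI_hom: "\<lbrakk>a \<in> Ob C; b \<in> Ob C; c \<in> Ob C\<rbrakk>
      \<Longrightarrow> AssocI C a b c \<in> hom C (a \<oplus> (b \<oplus> c)) ((a \<oplus> b) \<oplus> c)"
    and assoc_inv: "\<lbrakk>a \<in> Ob C; b \<in> Ob C; c \<in> Ob C\<rbrakk>
      \<Longrightarrow> AssocI C a b c \<cdot> Assoc C a b c = Ident C ((a \<oplus> b) \<oplus> c)
        \<and> Assoc C a b c \<cdot> AssocI C a b c = Ident C (a \<oplus> (b \<oplus> c))"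
    and assoc_nat: "\<lbrakk>f \<in> hom C a a'; g \<in> hom C b b'; h \<in> hom C c c'\<rbrakk>
      \<Longrightarrow> Assoc C a' b' c' \<cdot> ((f \<otimes> g) \<otimes> h) = (f \<otimes> (g \<otimes> h)) \<cdot> Assoc C a b c"
    and lun_hom: "a \<in> Ob C \<Longrightarrow> Lun C a \<in> hom C (Unit C \<oplus> a) a"
    and lunI_hom: "a \<in> Ob C \<Longrightarrow> LunI C a \<in> hom C a (Unit C \<oplus> a)"
    and lun_inv: "a \<in> Ob C \<Longrightarrow> LunI C a \<cdot> Lun C a = Ident C (Unit C \<oplus> a) \<and> Lun C a \<cdot> LunI C a = Ident C a"
    and lun_nat: "f \<in> hom C a b \<Longrightarrow> Lun C b \<cdot> (Ident C (Unit C) \<otimes> f) = f \<cdot> Lun C a"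
    and run_hom: "a \<in> Ob C \<Longrightarrow> Run C a \<in> hom C (a \<oplus> Unit C) a"
    and runI_hom: "a \<in> Ob C \<Longrightarrow> RunI C a \<in> hom C a (a \<oplus> Unit C)"
    and run_inv: "a \<in> Ob C \<Longrightarrow> RunI C a \<cdot> Run C a = Ident C (a \<oplus> Unit C) \<and> Run C a \<cdot> RunI C a = Ident C a"
    and run_nat: "f \<in> hom C a b \<Longrightarrow> Run C b \<cdot> (f \<otimes> Ident C (Unit C)) = f \<cdot> Run C a"
    and pentagon: "\<lbrakk>a \<in> Ob C; b \<in> Ob C; c \<in> Ob C; d \<in> Ob C\<rbrakk>
      \<Longrightarrow> Assoc C a b (c \<oplus> d) \<cdot> Assoc C (a \<oplus> b) c d
        = (Ident C a \<otimes> Assoc C b c d) \<cdot> Assoc C a (b \<oplus> c) d \<cdot> (Assoc C a b c \<otimes> Ident C d)"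
    and triangle: "\<lbrakk>a \<in> Ob C; b \<in> Ob C\<rbrakk>
      \<Longrightarrow> (Ident C a \<otimes> Lun C b) \<cdot> Assoc C a (Unit C) b = Run C a \<otimes> Ident C b"

locale symmetric_monoidal_category = monoidal_category +
  assumes swap_hom: "\<lbrakk>a \<in> Ob C; b \<in> Ob C\<rbrakk> \<Longrightarrow> Swap C a b \<in> hom C (a \<oplus> b) (b \<oplus> a)"
    and swap_swap: "\<lbrakk>a \<in> Ob C; b \<in> Ob C\<rbrakk> \<Longrightarrow> Swap C b a \<cdot> Swap C a b = Ident C (a \<oplus> b)"
    and swap_nat: "\<lbrakk>f \<in> hom C a a'; g \<in> hom C b b'\<rbrakk>
      \<Longrightarrow> Swap C a' b' \<cdot> (f \<otimes> g) = (g \<otimes> f) \<cdot> Swap C a b"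
    and hexagon: "\<lbrakk>a \<in> Ob C; b \<in> Ob C; c \<in> Ob C\<rbrakk>
      \<Longrightarrow> Assoc C b c a \<cdot> Swap C a (b \<oplus> c) \<cdot> Assoc C a b c
        = (Ident C b \<otimes> Swap C a c) \<cdot> Assoc C b a c \<cdot> (Swap C a b \<otimes> Ident C c)"

definition interchange :: "('o, 'm, 'z) markov_cat_scheme \<Rightarrow> 'o \<Rightarrow> 'o \<Rightarrow> 'o \<Rightarrow> 'o \<Rightarrow> 'm"
  \<comment> \<open>\<open>(a \<oplus> b) \<oplus> (c \<oplus> d) \<rightarrow> (a \<oplus> c) \<oplus> (b \<oplus> d)\<close>\<close> where
  "interchange C a b c d =
     AssocI C a c (b \<oplus>\<^bsub>C\<^esub> d) \<cdot>\<^bsub>C\<^esub>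
     (Ident C a \<otimes>\<^bsub>C\<^esub> (Assoc C c b d \<cdot>\<^bsub>C\<^esub> (Swap C b c \<otimes>\<^bsub>C\<^esub> Ident C d) \<cdot>\<^bsub>C\<^esub> AssocI C b c d)) \<cdot>\<^bsub>C\<^esub>
     Assoc C a b (c \<oplus>\<^bsub>C\<^esub> d)"

locale markov_category = symmetric_monoidal_category +
  assumes copy_hom: "a \<in> Ob C \<Longrightarrow> Copy C a \<in> hom C a (a \<oplus> a)"
    and del_hom: "a \<in> Ob C \<Longrightarrow> Del C a \<in> hom C a (Unit C)"
    and coassoc: "a \<in> Ob C \<Longrightarrow>
      Assoc C a a a \<cdot> (Copy C a \<otimes> Ident C a) \<cdot> Copy C a = (Ident C a \<otimes> Copy C a) \<cdot> Copy C a"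
    and counit_left: "a \<in> Ob C \<Longrightarrow> Lun C a \<cdot> (Del C a \<otimes> Ident C a) \<cdot> Copy C a = Ident C a"
    and counit_right: "a \<in> Ob C \<Longrightarrow> Run C a \<cdot> (Ident C a \<otimes> Del C a) \<cdot> Copy C a = Ident C a"
    and cocomm: "a \<in> Ob C \<Longrightarrow> Swap C a a \<cdot> Copy C a = Copy C a"
    and copy_tensor: "\<lbrakk>a \<in> Ob C; b \<in> Ob C\<rbrakk> \<Longrightarrow>
      Copy C (a \<oplus> b) = interchange C a a b b \<cdot> (Copy C a \<otimes> Copy C b)"
    and del_tensor: "\<lbrakk>a \<in> Ob C; b \<in> Ob C\<rbrakk> \<Longrightarrow>
      Del C (a \<oplus> b) = Lun C (Unit C) \<cdot> (Del C a \<otimes> Del C b)"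
    and copy_unit: "Copy C (Unit C) = LunI C (Unit C)"
    and del_unit: "Del C (Unit C) = Ident C (Unit C)"
    and unit_terminal: "f \<in> hom C a (Unit C) \<Longrightarrow> f = Del C a"

definition deterministic :: "('o, 'm, 'z) markov_cat_scheme \<Rightarrow> 'm \<Rightarrow> bool" where
  "deterministic C f \<longleftrightarrow> f \<in> Ar C \<and>
     Copy C (Cod C f) \<cdot>\<^bsub>C\<^esub> f = (f \<otimes>\<^bsub>C\<^esub> f) \<cdot>\<^bsub>C\<^esub> Copy C (Dom C f)"

definition epic :: "('o, 'm, 'z) markov_cat_scheme \<Rightarrow> 'm \<Rightarrow> bool" where
  "epic C f \<longleftrightarrow> f \<in> Ar C \<and>
     (\<forall>c. \<forall>g \<in> hom C (Cod C f) c. \<forall>h \<in> hom C (Cod C f) c. g \<cdot>\<^bsub>C\<^esub> f = h \<cdot>\<^bsub>C\<^esub> f \<longrightarrow> g = h)"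

definition sharp_state :: "('o, 'm, 'z) markov_cat_scheme \<Rightarrow> 'o \<Rightarrow> 'm \<Rightarrow> bool" where
  "sharp_state C a x \<longleftrightarrow> x \<in> hom C (Unit C) a \<and> deterministic C x"


section \<open>Tensor products of lists\<close>

primrec tens :: "('o, 'm, 'z) markov_cat_scheme \<Rightarrow> 'o list \<Rightarrow> 'o" where
  "tens C [] = Unit C"
| "tens C (a # as) = a \<oplus>\<^bsub>C\<^esub> tens C as"

primrec mtens :: "('o, 'm, 'z) markov_cat_scheme \<Rightarrow> 'm list \<Rightarrow> 'm" where
  "mtens C [] = Ident C (Unit C)"
| "mtens C (f # fs) = f \<otimes>\<^bsub>C\<^esub> mtens C fs"

text \<open>
  The coherence isomorphism \<open>tens as \<oplus> tens bs \<rightarrow> tens (as @ bs)\<close>, its inverse, and their iterates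
  between \<open>tens (map tens ass)\<close> and \<open>tens (concat ass)\<close>.
\<close>

primrec join :: "('o, 'm, 'z) markov_cat_scheme \<Rightarrow> 'o list \<Rightarrow> 'o list \<Rightarrow> 'm" where
  "join C [] bs = Lun C (tens C bs)"
| "join C (a # as) bs = (Ident C a \<otimes>\<^bsub>C\<^esub> join C as bs) \<cdot>\<^bsub>C\<^esub> Assoc C a (tens C as) (tens C bs)"

primrec split :: "('o, 'm, 'z) markov_cat_scheme \<Rightarrow> 'o list \<Rightarrow> 'o list \<Rightarrow> 'm" where
  "split C [] bs = LunI C (tens C bs)"
| "split C (a # as) bs = AssocI C a (tens C as) (tens C bs) \<cdot>\<^bsub>C\<^esub> (Ident C a \<otimes>\<^bsub>C\<^esub> split C as bs)"

primrec joins :: "('o, 'm, 'z) markov_cat_scheme \<Rightarrow> 'o list list \<Rightarrow> 'm" where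
  "joins C [] = Ident C (Unit C)"
| "joins C (as # ass) = join C as (concat ass) \<cdot>\<^bsub>C\<^esub> (Ident C (tens C as) \<otimes>\<^bsub>C\<^esub> joins C ass)"

primrec splits :: "('o, 'm, 'z) markov_cat_scheme \<Rightarrow> 'o list list \<Rightarrow> 'm" where
  "splits C [] = Ident C (Unit C)"
| "splits C (as # ass) = (Ident C (tens C as) \<otimes>\<^bsub>C\<^esub> splits C ass) \<cdot>\<^bsub>C\<^esub> split C as (concat ass)"

primrec mcopy :: "('o, 'm, 'z) markov_cat_scheme \<Rightarrow> 'o \<Rightarrow> nat \<Rightarrow> 'm"
  \<comment> \<open>\<open>a \<rightarrow> tens (replicate m a)\<close>\<close> where
  "mcopy C a 0 = Del C a"
| "mcopy C a (Suc m) = (Ident C a \<otimes>\<^bsub>C\<^esub> mcopy C a m) \<cdot>\<^bsub>C\<^esub> Copy C a"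

primrec state_tens :: "('o, 'm, 'z) markov_cat_scheme \<Rightarrow> 'm list \<Rightarrow> 'm"
  \<comment> \<open>the tensor of states \<open>Unit \<rightarrow> a\<^sub>i\<close>, as a state of the tensor of the \<open>a\<^sub>i\<close>\<close> where
  "state_tens C [] = Ident C (Unit C)"
| "state_tens C (x # xs) = (x \<otimes>\<^bsub>C\<^esub> state_tens C xs) \<cdot>\<^bsub>C\<^esub> LunI C (Unit C)"

primrec distribute :: "('o, 'm, 'z) markov_cat_scheme \<Rightarrow> 'o \<Rightarrow> 'o list \<Rightarrow> 'm"
  \<comment> \<open>the permutation \<open>tens (replicate (length as) u) \<oplus> tens as \<rightarrow> tens (map (\<lambda>a. u \<oplus> a) as)\<close>\<close> where
  "distribute C u [] = Lun C (Unit C)"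
| "distribute C u (a # as) =
     (Ident C (u \<oplus>\<^bsub>C\<^esub> a) \<otimes>\<^bsub>C\<^esub> distribute C u as) \<cdot>\<^bsub>C\<^esub>
     interchange C u (tens C (replicate (length as) u)) a (tens C as)"

text \<open>
  Given an assignment \<open>ob\<close> of objects to variables: the marginal of a list of variables on the first
  occurrence of \<open>y\<close>, and the channel from the variables \<open>zs\<close> to the variables \<open>ys\<close> that copies,
  permutes and discards.
\<close>

primrec marg :: "('o, 'm, 'z) markov_cat_scheme \<Rightarrow> ('w \<Rightarrow> 'o) \<Rightarrow> 'w list \<Rightarrow> 'w \<Rightarrow> 'm" where
  "marg C ob [] y = undefined"
| "marg C ob (z # zs) y =
     (if z = y
      then Run C (ob z) \<cdot>\<^bsub>C\<^esub> (Ident C (ob z) \<otimes>\<^bsub>C\<^esub> Del C (tens C (map ob zs)))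
      else marg C ob zs y \<cdot>\<^bsub>C\<^esub> Lun C (tens C (map ob zs)) \<cdot>\<^bsub>C\<^esub>
             (Del C (ob z) \<otimes>\<^bsub>C\<^esub> Ident C (tens C (map ob zs))))"

primrec select :: "('o, 'm, 'z) markov_cat_scheme \<Rightarrow> ('w \<Rightarrow> 'o) \<Rightarrow> 'w list \<Rightarrow> 'w list \<Rightarrow> 'm" where
  "select C ob zs [] = Del C (tens C (map ob zs))"
| "select C ob zs (y # ys) =
     (marg C ob zs y \<otimes>\<^bsub>C\<^esub> select C ob zs ys) \<cdot>\<^bsub>C\<^esub> Copy C (tens C (map ob zs))"


section \<open>Functional causal models\<close>

text \<open>\<open>Endo v\<close> is the endogenous variable named \<open>v\<close>, and \<open>Exo v\<close> the exogenous variable attached to it.\<close>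

datatype 'v var = Endo 'v | Exo 'v

text \<open>
  A set of variables is represented by a list of its elements without repetition; \<open>endo\<close> lists the
  endogenous variables and \<open>pa v\<close> the endogenous parents of \<open>v\<close>.
\<close>

record ('v, 'o, 'm) fcm =
  endo :: "'v list"
  pa :: "'v \<Rightarrow> 'v list"
  vob :: "'v var \<Rightarrow> 'o"
  lam :: "'v \<Rightarrow> 'm"
  mech :: "'v \<Rightarrow> 'm"

abbreviation vars :: "('v, 'o, 'm, 'y) fcm_scheme \<Rightarrow> 'v set" where
  "vars M \<equiv> set (endo M)"

abbreviation eob :: "('v, 'o, 'm, 'y) fcm_scheme \<Rightarrow> 'v \<Rightarrow> 'o" where
  "eob M v \<equiv> vob M (Endo v)"

definition edges :: "('v, 'o, 'm, 'y) fcm_scheme \<Rightarrow> ('v var \<times> 'v var) set" where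
  "edges M = {(Endo p, Endo v) | p v. v \<in> vars M \<and> p \<in> set (pa M v)}
           \<union> {(Exo v, Endo v) | v. v \<in> vars M}"

definition functional_causal_model ::
    "('o, 'm, 'z) markov_cat_scheme \<Rightarrow> ('v, 'o, 'm, 'y) fcm_scheme \<Rightarrow> bool" where
  "functional_causal_model C M \<longleftrightarrow>
     distinct (endo M) \<and>
     (\<forall>v \<in> vars M. distinct (pa M v) \<and> set (pa M v) \<subseteq> vars M) \<and>
     acyclic (edges M) \<and>
     (\<forall>v \<in> vars M. vob M (Endo v) \<in> Ob C \<and> vob M (Exo v) \<in> Ob C) \<and>
     (\<forall>v \<in> vars M. lam M v \<in> hom C (Unit C) (vob M (Exo v))) \<and>
     (\<forall>v \<in> vars M. mech M v \<in> hom C (tens C (map (eob M) (pa M v)) \<oplus>\<^bsub>C\<^esub> vob M (Exo v)) (eob M v)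
                  \<and> deterministic C (mech M v))"

definition exo_ob :: "('o, 'm, 'z) markov_cat_scheme \<Rightarrow> ('v, 'o, 'm, 'y) fcm_scheme \<Rightarrow> 'o" where
  "exo_ob C M = tens C (map (\<lambda>v. vob M (Exo v)) (endo M))"

definition exo_state :: "('o, 'm, 'z) markov_cat_scheme \<Rightarrow> ('v, 'o, 'm, 'y) fcm_scheme \<Rightarrow> 'm" where
  "exo_state C M = state_tens C (map (lam M) (endo M))"

text \<open>
  The remaining mechanisms are wired together in a topological order; the resulting channel does not
  depend on which one is chosen.
\<close>

definition topological :: "('v, 'o, 'm, 'y) fcm_scheme \<Rightarrow> 'v list \<Rightarrow> bool" where
  "topological M vs \<longleftrightarrow> distinct vs \<and> set vs = vars M \<and>
     (\<forall>as v bs. vs = as @ v # bs \<longrightarrow> set (pa M v) \<subseteq> set as)"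

definition topo_order :: "('v, 'o, 'm, 'y) fcm_scheme \<Rightarrow> 'v list" where
  "topo_order M = (SOME vs. topological M vs)"

definition add_var ::
    "('o, 'm, 'z) markov_cat_scheme \<Rightarrow> ('v, 'o, 'm, 'y) fcm_scheme \<Rightarrow> 'v var list \<Rightarrow> 'v \<Rightarrow> 'm"
  \<comment> \<open>given the variables \<open>zs\<close>, add \<open>v\<close> by its mechanism, keeping a copy of \<open>zs\<close>\<close> where
  "add_var C M zs v =
     (let a = tens C (map (vob M) zs) in
      ((mech M v \<cdot>\<^bsub>C\<^esub> (select C (vob M) zs (map Endo (pa M v)) \<otimes>\<^bsub>C\<^esub> marg C (vob M) zs (Exo v)) \<cdot>\<^bsub>C\<^esub> Copy C a)
        \<otimes>\<^bsub>C\<^esub> Ident C a) \<cdot>\<^bsub>C\<^esub> Copy C a)"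

primrec wire ::
    "('o, 'm, 'z) markov_cat_scheme \<Rightarrow> ('v, 'o, 'm, 'y) fcm_scheme \<Rightarrow> 'v list \<Rightarrow> 'v var list \<Rightarrow> 'v var list \<Rightarrow> 'm" where
  "wire C M [] zs ys = select C (vob M) zs ys"
| "wire C M (v # vs) zs ys = wire C M vs (Endo v # zs) ys \<cdot>\<^bsub>C\<^esub> add_var C M zs v"

definition F_Do ::
    "('o, 'm, 'z) markov_cat_scheme \<Rightarrow> ('v, 'o, 'm, 'y) fcm_scheme \<Rightarrow> 'v list \<Rightarrow> 'v list \<Rightarrow> 'm"
  \<comment> \<open>\<open>U \<oplus> X \<rightarrow> Y\<close>\<close> where
  "F_Do C M X Y =
     wire C M (filter (\<lambda>v. v \<notin> set X) (topo_order M)) (map Exo (endo M) @ map Endo X) (map Endo Y) \<cdot>\<^bsub>C\<^esub>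
     join C (map (\<lambda>v. vob M (Exo v)) (endo M)) (map (eob M) X)"


section \<open>Query signatures and upward abstractions\<close>

record ('t, 'q) signature =
  types :: "'t set"
  queries :: "'q set"
  qins :: "'q \<Rightarrow> 't list"
  qouts :: "'q \<Rightarrow> 't list"

record ('t, 'q, 'o, 'm) sig_model =
  tob :: "'t \<Rightarrow> 'o"
  qmor :: "'q \<Rightarrow> 'm"

definition wf_signature :: "('t, 'q) signature \<Rightarrow> bool" where
  "wf_signature S \<longleftrightarrow> (\<forall>q \<in> queries S. set (qins S q) \<subseteq> types S \<and> set (qouts S q) \<subseteq> types S)"

definition models ::
    "('o, 'm, 'z) markov_cat_scheme \<Rightarrow> ('t, 'q) signature \<Rightarrow> ('t, 'q, 'o, 'm) sig_model \<Rightarrow> bool" where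
  "models C S N \<longleftrightarrow> tob N ` types S \<subseteq> Ob C \<and>
     (\<forall>q \<in> queries S.
        qmor N q \<in> hom C (tens C (map (tob N) (qins S q))) (tens C (map (tob N) (qouts S q))))"

definition pi_list :: "('h \<Rightarrow> 'l list) \<Rightarrow> 'h list \<Rightarrow> 'l list" where
  "pi_list \<pi> Xs = concat (map \<pi> Xs)"

definition tau_list ::
    "('o, 'm, 'z) markov_cat_scheme \<Rightarrow> ('l \<Rightarrow> 'o) \<Rightarrow> ('h \<Rightarrow> 'l list) \<Rightarrow> ('h \<Rightarrow> 'm) \<Rightarrow> 'h list \<Rightarrow> 'm"
  \<comment> \<open>the tensor of the \<open>\<tau> X\<close>, from \<open>tens (map ob (pi_list \<pi> Xs))\<close> to the tensor of the \<open>X\<close>\<close> where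
  "tau_list C ob \<pi> \<tau> Xs = mtens C (map \<tau> Xs) \<cdot>\<^bsub>C\<^esub> splits C (map (\<lambda>X. map ob (\<pi> X)) Xs)"

definition upward_abstraction ::
    "('o, 'm, 'z) markov_cat_scheme
      \<Rightarrow> ('l, 'p) signature \<Rightarrow> ('l, 'p, 'o, 'm) sig_model
      \<Rightarrow> ('h, 'q) signature \<Rightarrow> ('h, 'q, 'o, 'm) sig_model
      \<Rightarrow> ('h \<Rightarrow> 'l list) \<Rightarrow> ('h \<Rightarrow> 'm) \<Rightarrow> ('p \<rightharpoonup> 'q) \<Rightarrow> bool" where
  "upward_abstraction C SL L SH H \<pi> \<tau> \<omega> \<longleftrightarrow>
     wf_signature SL \<and> models C SL L \<and> wf_signature SH \<and> models C SH H \<and>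
     (\<forall>X \<in> types SH. set (\<pi> X) \<subseteq> types SL \<and>
        \<tau> X \<in> hom C (tens C (map (tob L) (\<pi> X))) (tob H X) \<and> epic C (\<tau> X) \<and> deterministic C (\<tau> X)) \<and>
     (\<forall>Xs. set Xs \<subseteq> types SH \<longrightarrow> epic C (tau_list C (tob L) \<pi> \<tau> Xs)) \<and>
     dom \<omega> \<subseteq> queries SL \<and> ran \<omega> = queries SH \<and>
     (\<forall>p q. \<omega> p = Some q \<longrightarrow>
        qins SL p = pi_list \<pi> (qins SH q) \<and> qouts SL p = pi_list \<pi> (qouts SH q) \<and>
        tau_list C (tob L) \<pi> \<tau> (qouts SH q) \<cdot>\<^bsub>C\<^esub> qmor L p
          = qmor H q \<cdot>\<^bsub>C\<^esub> tau_list C (tob L) \<pi> \<tau> (qins SH q))"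


section \<open>Concrete counterfactual queries\<close>

text \<open>The query \<open>[Y\<^sub>1|\<^sub>x\<^sub>1, \<dots>, Y\<^sub>m|\<^sub>x\<^sub>m]\<close> is the list of the triples \<open>(X\<^sub>j, x\<^sub>j, Y\<^sub>j)\<close>.\<close>

type_synonym ('v, 'm) cf_query = "('v list \<times> 'm \<times> 'v list) list"

definition CFc :: "('o, 'm, 'z) markov_cat_scheme \<Rightarrow> 'v set \<Rightarrow> ('v \<Rightarrow> 'o) \<Rightarrow> ('v, 'm) cf_query set" where
  "CFc C V ob = {q. \<forall>(X, x, Y) \<in> set q.
     distinct X \<and> set X \<subseteq> V \<and> distinct Y \<and> set Y \<subseteq> V \<and> sharp_state C (tens C (map ob X)) x}"

definition cf_sem ::
    "('o, 'm, 'z) markov_cat_scheme \<Rightarrow> ('v, 'o, 'm, 'y) fcm_scheme \<Rightarrow> ('v, 'm) cf_query \<Rightarrow> 'm" where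
  "cf_sem C M q =
     joins C (map (\<lambda>(X, x, Y). map (eob M) Y) q) \<cdot>\<^bsub>C\<^esub>
     mtens C (map (\<lambda>(X, x, Y). F_Do C M X Y) q) \<cdot>\<^bsub>C\<^esub>
     distribute C (exo_ob C M) (map (\<lambda>(X, x, Y). tens C (map (eob M) X)) q) \<cdot>\<^bsub>C\<^esub>
     ((mcopy C (exo_ob C M) (length q) \<cdot>\<^bsub>C\<^esub> exo_state C M)
        \<otimes>\<^bsub>C\<^esub> state_tens C (map (\<lambda>(X, x, Y). x) q)) \<cdot>\<^bsub>C\<^esub>
     LunI C (Unit C)"

definition cf_signature :: "'v set \<Rightarrow> ('v, 'm) cf_query set \<Rightarrow> ('v, ('v, 'm) cf_query) signature" where
  "cf_signature V Q =
     \<lparr>types = V, queries = Q, qins = (\<lambda>q. []), qouts = (\<lambda>q. concat (map (\<lambda>(X, x, Y). Y) q))\<rparr>"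

definition cf_model ::
    "('o, 'm, 'z) markov_cat_scheme \<Rightarrow> ('v, 'o, 'm, 'y) fcm_scheme
      \<Rightarrow> ('v, ('v, 'm) cf_query, 'o, 'm) sig_model" where
  "cf_model C M = \<lparr>tob = eob M, qmor = cf_sem C M\<rparr>"


section \<open>Variable alignments and consistency\<close>

definition variable_alignment ::
    "('o, 'm, 'z) markov_cat_scheme \<Rightarrow> ('l, 'o, 'm, 'y) fcm_scheme \<Rightarrow> ('h, 'o, 'm, 'x) fcm_scheme
      \<Rightarrow> ('h \<Rightarrow> 'l list) \<Rightarrow> ('h \<Rightarrow> 'm) \<Rightarrow> bool" where
  "variable_alignment C L H \<pi> \<tau> \<longleftrightarrow>
     (\<forall>X \<in> vars H. distinct (\<pi> X) \<and> set (\<pi> X) \<subseteq> vars L) \<and>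
     (\<forall>X \<in> vars H. \<forall>X' \<in> vars H. X \<noteq> X' \<longrightarrow> set (\<pi> X) \<inter> set (\<pi> X') = {}) \<and>
     (\<forall>X \<in> vars H. \<tau> X \<in> hom C (tens C (map (eob L) (\<pi> X))) (eob H X)
                  \<and> epic C (\<tau> X) \<and> deterministic C (\<tau> X)) \<and>
     (\<forall>Xs. set Xs \<subseteq> vars H \<longrightarrow> epic C (tau_list C (eob L) \<pi> \<tau> Xs))"

text \<open>
  The data \<open>X\<^sub>j, Y\<^sub>j \<subseteq> V\<^sub>H\<close> with sharp states \<open>x\<^sub>j\<close> of \<open>\<pi>(X\<^sub>j)\<close>, and the queries
  \<open>[\<pi>(Y\<^sub>1)|\<^sub>x\<^sub>1, \<dots>]\<close> and \<open>[Y\<^sub>1|\<^sub>\<tau>\<^sub>\<circ>\<^sub>x\<^sub>1, \<dots>]\<close> they give rise to.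
\<close>

definition aligned_data ::
    "('o, 'm, 'z) markov_cat_scheme \<Rightarrow> ('l, 'o, 'm, 'y) fcm_scheme \<Rightarrow> ('h, 'o, 'm, 'x) fcm_scheme
      \<Rightarrow> ('h \<Rightarrow> 'l list) \<Rightarrow> ('h list \<times> 'm \<times> 'h list) list set" where
  "aligned_data C L H \<pi> = {d. \<forall>(X, x, Y) \<in> set d.
     distinct X \<and> set X \<subseteq> vars H \<and> distinct Y \<and> set Y \<subseteq> vars H \<and>
     sharp_state C (tens C (map (eob L) (pi_list \<pi> X))) x}"

definition low_query :: "('h \<Rightarrow> 'l list) \<Rightarrow> ('h list \<times> 'm \<times> 'h list) list \<Rightarrow> ('l, 'm) cf_query" where
  "low_query \<pi> d = map (\<lambda>(X, x, Y). (pi_list \<pi> X, x, pi_list \<pi> Y)) d"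

definition high_query ::
    "('o, 'm, 'z) markov_cat_scheme \<Rightarrow> ('l, 'o, 'm, 'y) fcm_scheme \<Rightarrow> ('h \<Rightarrow> 'l list) \<Rightarrow> ('h \<Rightarrow> 'm)
      \<Rightarrow> ('h list \<times> 'm \<times> 'h list) list \<Rightarrow> ('h, 'm) cf_query" where
  "high_query C L \<pi> \<tau> d = map (\<lambda>(X, x, Y). (X, tau_list C (eob L) \<pi> \<tau> X \<cdot>\<^bsub>C\<^esub> x, Y)) d"

definition tau_blocks ::
    "('o, 'm, 'z) markov_cat_scheme \<Rightarrow> ('l, 'o, 'm, 'y) fcm_scheme \<Rightarrow> ('h, 'o, 'm, 'x) fcm_scheme
      \<Rightarrow> ('h \<Rightarrow> 'l list) \<Rightarrow> ('h \<Rightarrow> 'm) \<Rightarrow> 'h list list \<Rightarrow> 'm"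
  \<comment> \<open>the tensor of \<open>\<tau>\<^bsub>Y\<^sub>1\<^esub>, \<dots>, \<tau>\<^bsub>Y\<^sub>m\<^esub>\<close>, between the concatenations of the \<open>\<pi>(Y\<^sub>j)\<close> and of the \<open>Y\<^sub>j\<close>\<close> where
  "tau_blocks C L H \<pi> \<tau> Ys =
     joins C (map (map (eob H)) Ys) \<cdot>\<^bsub>C\<^esub>
     mtens C (map (tau_list C (eob L) \<pi> \<tau>) Ys) \<cdot>\<^bsub>C\<^esub>
     splits C (map (\<lambda>Y. map (eob L) (pi_list \<pi> Y)) Ys)"

definition consistent ::
    "('o, 'm, 'z) markov_cat_scheme \<Rightarrow> ('l, 'o, 'm, 'y) fcm_scheme \<Rightarrow> ('h, 'o, 'm, 'x) fcm_scheme
      \<Rightarrow> ('h \<Rightarrow> 'l list) \<Rightarrow> ('h \<Rightarrow> 'm) \<Rightarrow> ('h, 'm) cf_query set \<Rightarrow> bool" where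
  "consistent C L H \<pi> \<tau> Q \<longleftrightarrow>
     (\<forall>d \<in> aligned_data C L H \<pi>. high_query C L \<pi> \<tau> d \<in> Q \<longrightarrow>
        tau_blocks C L H \<pi> \<tau> (map (\<lambda>(X, x, Y). Y) d) \<cdot>\<^bsub>C\<^esub> cf_sem C L (low_query \<pi> d)
          = cf_sem C H (high_query C L \<pi> \<tau> d))"

text \<open>
  The lists of variables occurring in some query. An alignment may send a variable to the empty set, so
  different lists \<open>Y\<close> may have the same \<open>\<pi>(Y)\<close>; by the lemma this cannot happen otherwise.
  When it happens within a set of queries, a low query need not determine the high query it is aligned
  with. Moreover sharp states need not lift along an epic channel, so a query over the high-level variables
  need not be of the form \<open>high_query C L \<pi> \<tau> d\<close> with \<open>d\<close> in \<open>aligned_data C L H \<pi>\<close>.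
\<close>

definition occurring :: "('v, 'm) cf_query set \<Rightarrow> 'v list set" where
  "occurring Q = (\<Union>q \<in> Q. \<Union>(X, x, Y) \<in> set q. {X, Y})"

lemma inj_on_pi_list:
  assumes "variable_alignment C L H \<pi> \<tau>" and "\<And>X. X \<in> vars H \<Longrightarrow> \<pi> X \<noteq> []"
  shows "inj_on (pi_list \<pi>) (lists (vars H))"
proof (rule inj_onI)
  fix xs ys
  assume "xs \<in> lists (vars H)" "ys \<in> lists (vars H)" "pi_list \<pi> xs = pi_list \<pi> ys"
  then show "xs = ys"
  proof (induction xs arbitrary: ys rule: list.induct)
    case Nil
    then show ?case using assms(2) by (cases ys) (auto simp: pi_list_def)
  next
    case (Cons x xs)
    then obtain y zs where ys: "ys = y # zs"
      using assms(2) by (cases ys) (auto simp: pi_list_def)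
    have ne: "\<pi> x \<noteq> []" "\<pi> y \<noteq> []" and xy: "x \<in> vars H" "y \<in> vars H"
      using Cons.prems ys assms(2) by auto
    have "\<pi> x @ pi_list \<pi> xs = \<pi> y @ pi_list \<pi> zs"
      using Cons.prems ys by (simp add: pi_list_def)
    then have "hd (\<pi> x) = hd (\<pi> y)"
      using ne by (metis hd_append2)
    then have "set (\<pi> x) \<inter> set (\<pi> y) \<noteq> {}"
      using ne by (metis disjoint_iff hd_in_set)
    then have "x = y"
      using xy assms(1) unfolding variable_alignment_def by blast
    then show ?case using Cons ys by (simp add: pi_list_def)
  qed
qed

end

theory Submission
  imports Defs
begin

text \<open>
  Every condition of an upward abstraction other than the commutation with \<open>\<omega>\<close> holds by the hypotheses:
  the counterfactual states are well typed because a finite acyclic graph has a topological order, and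
  \<open>\<omega>\<close> is single-valued because a low query, by injectivity of \<open>\<pi>\<close> on the lists that occur,
  determines the data it comes from. The commutation is the consistency equation once the tensor of the
  \<open>\<tau>\<close> over the concatenated outputs is identified with the tensor of the blocks \<open>\<tau>\<^bsub>Y\<^sub>j\<^esub>\<close>. As the
  category is not strict, this is a coherence statement, proved by induction from the pentagon and
  \<open>Lun (b \<oplus> c) \<cdot> Assoc Unit b c = Lun b \<otimes> Ident c\<close>.
\<close>

section \<open>Typed rewriting in categories and monoidal categories\<close>

context category
begin

text \<open>Through \<open>Dom\<close> and \<open>Cod\<close> the typing conditions of the
  categorical laws become equations that can be computed, so no intermediate object has to be
  guessed. The laws are restated in this form and nest composites to the right.\<close>

lemma hom_iff: "f \<in> hom C a b \<longleftrightarrow> f \<in> Ar C \<and> Dom C f = a \<and> Cod C f = b"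
  by (simp add: hom_def)

lemma ar_in_hom: "f \<in> Ar C \<Longrightarrow> f \<in> hom C (Dom C f) (Cod C f)"
  by (simp add: hom_def)

lemma dom_ob [simp]: "f \<in> Ar C \<Longrightarrow> Dom C f \<in> Ob C"
  and cod_ob [simp]: "f \<in> Ar C \<Longrightarrow> Cod C f \<in> Ob C"
  using dom_cod by auto

lemma hom_cod_ob: "f \<in> hom C a b \<Longrightarrow> b \<in> Ob C"
  by (auto simp: hom_iff)

lemma ident_typing [simp]:
  assumes "a \<in> Ob C"
  shows "Ident C a \<in> Ar C" "Dom C (Ident C a) = a" "Cod C (Ident C a) = a"
  using ident_hom[OF assms] by (auto simp: hom_iff)

lemma comp_typing [simp]:
  assumes "f \<in> Ar C" "g \<in> Ar C" "Dom C g = Cod C f"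
  shows "g \<cdot> f \<in> Ar C" "Dom C (g \<cdot> f) = Dom C f" "Cod C (g \<cdot> f) = Cod C g"
  using comp_hom[of f "Dom C f" "Cod C f" g "Cod C g"] assms by (auto simp: hom_iff)

lemma comp_assoc_ar [simp]:
  assumes "f \<in> Ar C" "g \<in> Ar C" "h \<in> Ar C" "Dom C g = Cod C f" "Dom C h = Cod C g"
  shows "(h \<cdot> g) \<cdot> f = h \<cdot> g \<cdot> f"
  using comp_assoc[of f "Dom C f" "Cod C f" g "Cod C g" h "Cod C h"] assms by (auto simp: hom_iff)

lemma comp_ident_left [simp]: "f \<in> Ar C \<Longrightarrow> Cod C f = b \<Longrightarrow> Ident C b \<cdot> f = f"
  using ident_left[OF ar_in_hom] by auto

lemma comp_ident_right [simp]: "f \<in> Ar C \<Longrightarrow> Dom C f = a \<Longrightarrow> f \<cdot> Ident C a = f"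
  using ident_right[OF ar_in_hom] by auto

end

context monoidal_category
begin

declare unit_ob [simp] tensor_ob [simp] tensor_ident [simp]

lemma tensor_typing [simp]:
  assumes "f \<in> Ar C" "g \<in> Ar C"
  shows "f \<otimes> g \<in> Ar C" "Dom C (f \<otimes> g) = Dom C f \<oplus> Dom C g" "Cod C (f \<otimes> g) = Cod C f \<oplus> Cod C g"
  using tensor_hom[OF ar_in_hom ar_in_hom, OF assms] by (auto simp: hom_iff)

lemma assoc_typing [simp]:
  assumes "a \<in> Ob C" "b \<in> Ob C" "c \<in> Ob C"
  shows "Assoc C a b c \<in> Ar C" "Dom C (Assoc C a b c) = (a \<oplus> b) \<oplus> c"
    "Cod C (Assoc C a b c) = a \<oplus> (b \<oplus> c)"
    "AssocI C a b c \<in> Ar C" "Dom C (AssocI C a b c) = a \<oplus> (b \<oplus> c)"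
    "Cod C (AssocI C a b c) = (a \<oplus> b) \<oplus> c"
  using assoc_hom[OF assms] assocI_hom[OF assms] by (auto simp: hom_iff)

lemma unitor_typing [simp]:
  assumes "a \<in> Ob C"
  shows "Lun C a \<in> Ar C" "Dom C (Lun C a) = Unit C \<oplus> a" "Cod C (Lun C a) = a"
    "LunI C a \<in> Ar C" "Dom C (LunI C a) = a" "Cod C (LunI C a) = Unit C \<oplus> a"
    "Run C a \<in> Ar C" "Dom C (Run C a) = a \<oplus> Unit C" "Cod C (Run C a) = a"
  using lun_hom[OF assms] lunI_hom[OF assms] run_hom[OF assms] by (auto simp: hom_iff)

lemma tensor_merge [simp]:
  assumes "f \<in> Ar C" "g \<in> Ar C" "f' \<in> Ar C" "g' \<in> Ar C" "Dom C g = Cod C f" "Dom C g' = Cod C f'"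
  shows "(g \<otimes> g') \<cdot> (f \<otimes> f') = (g \<cdot> f) \<otimes> (g' \<cdot> f')"
  using tensor_comp[of f "Dom C f" "Cod C f" g "Cod C g" f' "Dom C f'" "Cod C f'" g' "Cod C g'"] assms
  by (auto simp: hom_iff)

text \<open>In a right-nested composite the two factors to be merged are followed by a tail
  \<open>k\<close>. The variants \<open>_comp\<close> of the cancellation laws serve the same
  purpose.\<close>

lemma tensor_merge_comp [simp]:
  assumes "f \<in> Ar C" "g \<in> Ar C" "f' \<in> Ar C" "g' \<in> Ar C" "Dom C g = Cod C f" "Dom C g' = Cod C f'"
    and "k \<in> Ar C" "Cod C k = Dom C f \<oplus> Dom C f'"
  shows "(g \<otimes> g') \<cdot> (f \<otimes> f') \<cdot> k = ((g \<cdot> f) \<otimes> (g' \<cdot> f')) \<cdot> k"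
  using assms comp_assoc_ar[of k "f \<otimes> f'" "g \<otimes> g'"] by simp

lemma assoc_inverse [simp]:
  assumes "a \<in> Ob C" "b \<in> Ob C" "c \<in> Ob C"
  shows "AssocI C a b c \<cdot> Assoc C a b c = Ident C ((a \<oplus> b) \<oplus> c)"
    "Assoc C a b c \<cdot> AssocI C a b c = Ident C (a \<oplus> (b \<oplus> c))"
  using assoc_inv[OF assms] by auto

lemma assoc_inverse_comp [simp]:
  assumes "a \<in> Ob C" "b \<in> Ob C" "c \<in> Ob C" "k \<in> Ar C"
  shows "Cod C k = (a \<oplus> b) \<oplus> c \<Longrightarrow> AssocI C a b c \<cdot> Assoc C a b c \<cdot> k = k"
    "Cod C k = a \<oplus> (b \<oplus> c) \<Longrightarrow> Assoc C a b c \<cdot> AssocI C a b c \<cdot> k = k"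
  using assms comp_assoc_ar[of k "Assoc C a b c" "AssocI C a b c"]
    comp_assoc_ar[of k "AssocI C a b c" "Assoc C a b c"] by simp_all

lemma lun_inverse [simp]:
  assumes "a \<in> Ob C"
  shows "LunI C a \<cdot> Lun C a = Ident C (Unit C \<oplus> a)" "Lun C a \<cdot> LunI C a = Ident C a"
  using lun_inv[OF assms] by auto

lemma lun_inverse_comp [simp]:
  assumes "a \<in> Ob C" "k \<in> Ar C"
  shows "Cod C k = Unit C \<oplus> a \<Longrightarrow> LunI C a \<cdot> Lun C a \<cdot> k = k"
    "Cod C k = a \<Longrightarrow> Lun C a \<cdot> LunI C a \<cdot> k = k"
  using assms comp_assoc_ar[of k "Lun C a" "LunI C a"] comp_assoc_ar[of k "LunI C a" "Lun C a"]
  by simp_all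

section \<open>Naturality and coherence of the unitor and the associator\<close>

lemma assoc_nat_ar:
  assumes "f \<in> Ar C" "g \<in> Ar C" "h \<in> Ar C"
  shows "Assoc C (Cod C f) (Cod C g) (Cod C h) \<cdot> ((f \<otimes> g) \<otimes> h)
    = (f \<otimes> (g \<otimes> h)) \<cdot> Assoc C (Dom C f) (Dom C g) (Dom C h)"
  using assoc_nat[OF ar_in_hom ar_in_hom ar_in_hom, OF assms] .

lemma assocI_nat:
  assumes "f \<in> Ar C" "g \<in> Ar C" "h \<in> Ar C"
  shows "AssocI C (Cod C f) (Cod C g) (Cod C h) \<cdot> (f \<otimes> (g \<otimes> h))
    = ((f \<otimes> g) \<otimes> h) \<cdot> AssocI C (Dom C f) (Dom C g) (Dom C h)"
proof -
  let ?A = "Assoc C (Dom C f) (Dom C g) (Dom C h)" and ?A' = "AssocI C (Dom C f) (Dom C g) (Dom C h)"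
  let ?B = "Assoc C (Cod C f) (Cod C g) (Cod C h)" and ?B' = "AssocI C (Cod C f) (Cod C g) (Cod C h)"
  \<comment> \<open>Inserting \<open>?A \<cdot> ?A'\<close> on the right lets naturality of
    \<open>Assoc\<close> apply; it produces \<open>?B\<close>, which cancels against
    \<open>?B'\<close>.\<close>
  have "?B' \<cdot> (f \<otimes> (g \<otimes> h)) = ?B' \<cdot> ((f \<otimes> (g \<otimes> h)) \<cdot> ?A) \<cdot> ?A'"
    using assms by (simp del: tensor_merge tensor_merge_comp)
  also have "\<dots> = ((f \<otimes> g) \<otimes> h) \<cdot> ?A'"
    using assms unfolding assoc_nat_ar[OF assms, symmetric] by simp
  finally show ?thesis .
qed

lemma lun_nat_ar:
  assumes "f \<in> Ar C"
  shows "Lun C (Cod C f) \<cdot> (Ident C (Unit C) \<otimes> f) = f \<cdot> Lun C (Dom C f)"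
  using lun_nat[OF ar_in_hom, OF assms] .

lemma lunI_nat:
  assumes "f \<in> Ar C"
  shows "LunI C (Cod C f) \<cdot> f = (Ident C (Unit C) \<otimes> f) \<cdot> LunI C (Dom C f)"
proof -
  have "LunI C (Cod C f) \<cdot> f = LunI C (Cod C f) \<cdot> (f \<cdot> Lun C (Dom C f)) \<cdot> LunI C (Dom C f)"
    using assms by simp
  also have "\<dots> = (Ident C (Unit C) \<otimes> f) \<cdot> LunI C (Dom C f)"
    using assms unfolding lun_nat_ar[OF assms, symmetric] by simp
  finally show ?thesis .
qed

text \<open>\<open>Lun\<close> is a natural isomorphism from tensoring with the unit to the identity
  functor, so a morphism is recovered from its tensor with the unit.\<close>

lemma unit_tensor_faithful:
  assumes "f \<in> Ar C" "g \<in> Ar C" "Dom C f = Dom C g" "Cod C f = Cod C g"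
    and "Ident C (Unit C) \<otimes> f = Ident C (Unit C) \<otimes> g"
  shows "f = g"
proof -
  have "f \<cdot> Lun C (Dom C f) = g \<cdot> Lun C (Dom C f)"
    using lun_nat_ar[of f] lun_nat_ar[of g] assms by simp
  then have "(f \<cdot> Lun C (Dom C f)) \<cdot> LunI C (Dom C f) = (g \<cdot> Lun C (Dom C f)) \<cdot> LunI C (Dom C f)"
    by simp
  then show ?thesis
    using assms by simp
qed

text \<open>
  Kelly's argument: after tensoring with the unit object, the pentagon and the triangle reduce both sides
  to \<open>Run C (Unit C)\<close> tensored with an identity.
\<close>

lemma lun_tensor:
  assumes "b \<in> Ob C" "c \<in> Ob C"
  shows "Lun C (b \<oplus> c) \<cdot> Assoc C (Unit C) b c = Lun C b \<otimes> Ident C c"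
proof (rule unit_tensor_faithful)
  let ?I = "Unit C" and ?i = "Ident C (Unit C)"
  \<comment> \<open>\<open>?P\<close> is the leg of the pentagon to be cancelled: its inverse is
    \<open>?P'\<close>, so both sides may be compared after precomposition with it.\<close>
  let ?P = "Assoc C ?I (?I \<oplus> b) c \<cdot> (Assoc C ?I ?I b \<otimes> Ident C c)"
  let ?P' = "(AssocI C ?I ?I b \<otimes> Ident C c) \<cdot> AssocI C ?I (?I \<oplus> b) c"
  have "(?i \<otimes> (Lun C (b \<oplus> c) \<cdot> Assoc C ?I b c)) \<cdot> ?P
      = (?i \<otimes> Lun C (b \<oplus> c)) \<cdot> (?i \<otimes> Assoc C ?I b c) \<cdot> ?P"
    using assms by simp
  also have "(?i \<otimes> Assoc C ?I b c) \<cdot> ?P = Assoc C ?I ?I (b \<oplus> c) \<cdot> Assoc C (?I \<oplus> ?I) b c"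
    using pentagon[of ?I ?I b c] assms by simp
  also have "(?i \<otimes> Lun C (b \<oplus> c)) \<cdot> \<dots>
      = ((?i \<otimes> Lun C (b \<oplus> c)) \<cdot> Assoc C ?I ?I (b \<oplus> c)) \<cdot> Assoc C (?I \<oplus> ?I) b c"
    using assms by simp
  also have "\<dots> = (Run C ?I \<otimes> (Ident C b \<otimes> Ident C c)) \<cdot> Assoc C (?I \<oplus> ?I) b c"
    using triangle[of ?I "b \<oplus> c"] assms by simp
  also have "\<dots> = Assoc C ?I b c \<cdot> ((Run C ?I \<otimes> Ident C b) \<otimes> Ident C c)"
    using assoc_nat_ar[of "Run C ?I" "Ident C b" "Ident C c"] assms by simp
  also have "\<dots> = Assoc C ?I b c \<cdot> (((?i \<otimes> Lun C b) \<cdot> Assoc C ?I ?I b) \<otimes> Ident C c)"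
    using triangle[of ?I b] assms by simp
  also have "\<dots> = (Assoc C ?I b c \<cdot> ((?i \<otimes> Lun C b) \<otimes> Ident C c)) \<cdot> (Assoc C ?I ?I b \<otimes> Ident C c)"
    using assms by simp
  also have "\<dots> = (?i \<otimes> (Lun C b \<otimes> Ident C c)) \<cdot> ?P"
    using assoc_nat_ar[of ?i "Lun C b" "Ident C c"] assms by simp
  finally have "((?i \<otimes> (Lun C (b \<oplus> c) \<cdot> Assoc C ?I b c)) \<cdot> ?P) \<cdot> ?P'
      = ((?i \<otimes> (Lun C b \<otimes> Ident C c)) \<cdot> ?P) \<cdot> ?P'"
    by simp
  then show "?i \<otimes> (Lun C (b \<oplus> c) \<cdot> Assoc C ?I b c) = ?i \<otimes> (Lun C b \<otimes> Ident C c)"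
    using assms by simp
qed (use assms in simp_all)

lemma lunI_tensor:
  assumes "b \<in> Ob C" "c \<in> Ob C"
  shows "Assoc C (Unit C) b c \<cdot> (LunI C b \<otimes> Ident C c) = LunI C (b \<oplus> c)"
proof -
  have "Assoc C (Unit C) b c \<cdot> (LunI C b \<otimes> Ident C c)
      = LunI C (b \<oplus> c) \<cdot> (Lun C (b \<oplus> c) \<cdot> Assoc C (Unit C) b c) \<cdot> (LunI C b \<otimes> Ident C c)"
    using assms by simp
  also have "\<dots> = LunI C (b \<oplus> c)"
    using assms unfolding lun_tensor[OF assms] by simp
  finally show ?thesis .
qed

section \<open>Coherence for tensors of lists\<close>

lemma tens_ob [simp]: "set as \<subseteq> Ob C \<Longrightarrow> tens C as \<in> Ob C"
  by (induction as) auto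

lemma mtens_typing [simp]:
  assumes "set fs \<subseteq> Ar C"
  shows "mtens C fs \<in> Ar C" "Dom C (mtens C fs) = tens C (map (Dom C) fs)"
    "Cod C (mtens C fs) = tens C (map (Cod C) fs)"
  using assms by (induction fs) auto

lemma join_typing [simp]:
  assumes "set as \<subseteq> Ob C" "set bs \<subseteq> Ob C"
  shows "join C as bs \<in> Ar C" "Dom C (join C as bs) = tens C as \<oplus> tens C bs"
    "Cod C (join C as bs) = tens C (as @ bs)"
  using assms by (induction as) auto

lemma split_typing [simp]:
  assumes "set as \<subseteq> Ob C" "set bs \<subseteq> Ob C"
  shows "split C as bs \<in> Ar C" "Dom C (split C as bs) = tens C (as @ bs)"
    "Cod C (split C as bs) = tens C as \<oplus> tens C bs"
  using assms by (induction as) auto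

lemma joins_typing [simp]:
  assumes "\<Union> (set ` set ass) \<subseteq> Ob C"
  shows "joins C ass \<in> Ar C" "Dom C (joins C ass) = tens C (map (tens C) ass)"
    "Cod C (joins C ass) = tens C (concat ass)"
  using assms by (induction ass) auto

lemma splits_typing [simp]:
  assumes "\<Union> (set ` set ass) \<subseteq> Ob C"
  shows "splits C ass \<in> Ar C" "Dom C (splits C ass) = tens C (concat ass)"
    "Cod C (splits C ass) = tens C (map (tens C) ass)"
  using assms by (induction ass) auto

text \<open>\<open>join\<close> is built from \<open>Lun\<close> and \<open>Assoc\<close>, so its
  naturality follows from theirs by induction on the first list.\<close>

lemma mtens_append_join:
  assumes "set fs \<subseteq> Ar C" "set gs \<subseteq> Ar C"
  shows "mtens C (fs @ gs) \<cdot> join C (map (Dom C) fs) (map (Dom C) gs)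
    = join C (map (Cod C) fs) (map (Cod C) gs) \<cdot> (mtens C fs \<otimes> mtens C gs)"
  using assms(1)
proof (induction fs)
  case Nil
  then show ?case using lun_nat_ar[of "mtens C gs"] assms(2) by simp
next
  case (Cons f fs)
  let ?J = "join C (map (Dom C) fs) (map (Dom C) gs)" and ?K = "join C (map (Cod C) fs) (map (Cod C) gs)"
  let ?A = "Assoc C (Dom C f) (tens C (map (Dom C) fs)) (tens C (map (Dom C) gs))"
  have ob: "Dom C ` set fs \<subseteq> Ob C" "Dom C ` set gs \<subseteq> Ob C" "Cod C ` set fs \<subseteq> Ob C" "Cod C ` set gs \<subseteq> Ob C"
    using Cons.prems assms(2) by auto
  have "mtens C ((f # fs) @ gs) \<cdot> join C (map (Dom C) (f # fs)) (map (Dom C) gs)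
      = (f \<otimes> (mtens C (fs @ gs) \<cdot> ?J)) \<cdot> ?A"
    using Cons.prems assms(2) ob by simp
  also have "\<dots> = (f \<otimes> (?K \<cdot> (mtens C fs \<otimes> mtens C gs))) \<cdot> ?A"
    using Cons by simp
  also have "\<dots> = (Ident C (Cod C f) \<otimes> ?K) \<cdot> (f \<otimes> (mtens C fs \<otimes> mtens C gs)) \<cdot> ?A"
    using Cons.prems assms(2) ob by simp
  also have "(f \<otimes> (mtens C fs \<otimes> mtens C gs)) \<cdot> ?A
      = Assoc C (Cod C f) (tens C (map (Cod C) fs)) (tens C (map (Cod C) gs)) \<cdot> ((f \<otimes> mtens C fs) \<otimes> mtens C gs)"
    using assoc_nat_ar[of f "mtens C fs" "mtens C gs"] Cons.prems assms(2) by simp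
  finally show ?case
    using Cons.prems assms(2) ob by simp
qed

text \<open>The two orders of cutting a list into three pieces agree by coherence: for an empty
  first piece this is \<open>lunI_tensor\<close>, and each further object costs one
  pentagon.\<close>

lemma split_assoc:
  assumes "set as \<subseteq> Ob C" "set bs \<subseteq> Ob C" "set cs \<subseteq> Ob C"
  shows "(Ident C (tens C as) \<otimes> split C bs cs) \<cdot> split C as (bs @ cs)
    = Assoc C (tens C as) (tens C bs) (tens C cs) \<cdot> (split C as bs \<otimes> Ident C (tens C cs)) \<cdot> split C (as @ bs) cs"
  using assms(1)
proof (induction as)
  case Nil
  let ?B = "tens C bs" and ?C = "tens C cs"
  have "(Ident C (Unit C) \<otimes> split C bs cs) \<cdot> LunI C (tens C (bs @ cs)) = LunI C (?B \<oplus> ?C) \<cdot> split C bs cs"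
    using lunI_nat[of "split C bs cs"] assms by simp
  also have "\<dots> = (Assoc C (Unit C) ?B ?C \<cdot> (LunI C ?B \<otimes> Ident C ?C)) \<cdot> split C bs cs"
    using lunI_tensor[of ?B ?C] assms by simp
  finally show ?case
    using assms by simp
next
  case (Cons a as)
  let ?A = "tens C as" and ?B = "tens C bs" and ?C = "tens C cs" and ?i = "Ident C a"
  let ?s = "split C as bs" and ?t = "split C (as @ bs) cs"
  have ob [simp]: "a \<in> Ob C" "?A \<in> Ob C" "?B \<in> Ob C" "?C \<in> Ob C" "set as \<subseteq> Ob C"
      "set bs \<subseteq> Ob C" "set cs \<subseteq> Ob C"
    using Cons.prems assms by auto
  \<comment> \<open>The pentagon with every associator whose first index is \<open>a\<close>
    inverted, since \<open>split\<close> is built from \<open>AssocI\<close>.\<close>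
  have pent: "Assoc C (a \<oplus> ?A) ?B ?C \<cdot> (AssocI C a ?A ?B \<otimes> Ident C ?C) \<cdot> AssocI C a (?A \<oplus> ?B) ?C
      = AssocI C a ?A (?B \<oplus> ?C) \<cdot> (?i \<otimes> Assoc C ?A ?B ?C)" (is "?l = ?r")
  proof -
    have "?l = AssocI C a ?A (?B \<oplus> ?C) \<cdot> (Assoc C a ?A (?B \<oplus> ?C) \<cdot> Assoc C (a \<oplus> ?A) ?B ?C)
        \<cdot> (AssocI C a ?A ?B \<otimes> Ident C ?C) \<cdot> AssocI C a (?A \<oplus> ?B) ?C"
      by simp
    also have "\<dots> = ?r"
      unfolding pentagon[OF ob(1-4)] by simp
    finally show ?thesis .
  qed
  have "(Ident C (a \<oplus> ?A) \<otimes> split C bs cs) \<cdot> split C (a # as) (bs @ cs)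
      = (((?i \<otimes> Ident C ?A) \<otimes> split C bs cs) \<cdot> AssocI C a ?A (tens C (bs @ cs))) \<cdot> (?i \<otimes> split C as (bs @ cs))"
    by simp
  also have "\<dots> = (AssocI C a ?A (?B \<oplus> ?C) \<cdot> (?i \<otimes> (Ident C ?A \<otimes> split C bs cs))) \<cdot> (?i \<otimes> split C as (bs @ cs))"
    using assocI_nat[of ?i "Ident C ?A" "split C bs cs"] by simp
  also have "\<dots> = AssocI C a ?A (?B \<oplus> ?C) \<cdot> (?i \<otimes> (Assoc C ?A ?B ?C \<cdot> (?s \<otimes> Ident C ?C) \<cdot> ?t))"
    using Cons by simp
  also have "\<dots> = (AssocI C a ?A (?B \<oplus> ?C) \<cdot> (?i \<otimes> Assoc C ?A ?B ?C)) \<cdot> (?i \<otimes> (?s \<otimes> Ident C ?C)) \<cdot> (?i \<otimes> ?t)"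
    by simp
  also have "\<dots> = (Assoc C (a \<oplus> ?A) ?B ?C \<cdot> (AssocI C a ?A ?B \<otimes> Ident C ?C)) \<cdot>
      (AssocI C a (?A \<oplus> ?B) ?C \<cdot> (?i \<otimes> (?s \<otimes> Ident C ?C))) \<cdot> (?i \<otimes> ?t)"
    unfolding pent[symmetric] by simp
  also have "AssocI C a (?A \<oplus> ?B) ?C \<cdot> (?i \<otimes> (?s \<otimes> Ident C ?C))
      = ((?i \<otimes> ?s) \<otimes> Ident C ?C) \<cdot> AssocI C a (tens C (as @ bs)) ?C"
    using assocI_nat[of ?i ?s "Ident C ?C"] by simp
  finally show ?case
    by simp
qed

text \<open>Cutting into blocks may begin with the cut between the two lists of blocks:
  \<open>split_assoc\<close> moves this cut past the removal of each block of \<open>ass\<close>.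
  The \<open>join\<close> only reassociates the resulting tensor of blocks.\<close>

lemma splits_append:
  assumes "\<Union> (set ` set ass) \<subseteq> Ob C" "\<Union> (set ` set bss) \<subseteq> Ob C"
  shows "splits C (ass @ bss)
    = join C (map (tens C) ass) (map (tens C) bss) \<cdot> (splits C ass \<otimes> splits C bss)
      \<cdot> split C (concat ass) (concat bss)"
  using assms(1)
proof (induction ass)
  case Nil
  have *: "set (concat bss) \<subseteq> Ob C" "tens C ` set bss \<subseteq> Ob C"
    using assms(2) by (auto intro!: tens_ob)
  have "(Lun C (tens C (map (tens C) bss)) \<cdot> (Ident C (Unit C) \<otimes> splits C bss)) \<cdot> LunI C (tens C (concat bss))
      = splits C bss"
    using lun_nat_ar[of "splits C bss"] assms(2) * by simp
  then show ?case
    using assms(2) * by simp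
next
  case (Cons as ass)
  let ?J = "join C (map (tens C) ass) (map (tens C) bss)" and ?i = "Ident C (tens C as)"
  let ?S = "splits C ass" and ?T = "splits C bss"
  have ob [simp]: "set as \<subseteq> Ob C" "set (concat ass) \<subseteq> Ob C" "set (concat bss) \<subseteq> Ob C"
      "tens C ` set ass \<subseteq> Ob C" "tens C ` set bss \<subseteq> Ob C"
      "\<Union> (set ` set ass) \<subseteq> Ob C" "\<Union> (set ` set bss) \<subseteq> Ob C"
    using Cons.prems assms(2) by (auto intro!: tens_ob)
  have "splits C ((as # ass) @ bss) = (?i \<otimes> (?J \<cdot> (?S \<otimes> ?T))) \<cdot>
      (?i \<otimes> split C (concat ass) (concat bss)) \<cdot> split C as (concat ass @ concat bss)"
    using Cons ob by simp
  also have "\<dots> = (?i \<otimes> ?J) \<cdot>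
      ((?i \<otimes> (?S \<otimes> ?T)) \<cdot> Assoc C (tens C as) (tens C (concat ass)) (tens C (concat bss))) \<cdot>
      (split C as (concat ass) \<otimes> Ident C (tens C (concat bss))) \<cdot> split C (as @ concat ass) (concat bss)"
    unfolding split_assoc[OF ob(1-3)] using ob by simp
  also have "(?i \<otimes> (?S \<otimes> ?T)) \<cdot> Assoc C (tens C as) (tens C (concat ass)) (tens C (concat bss))
      = Assoc C (tens C as) (tens C (map (tens C) ass)) (tens C (map (tens C) bss)) \<cdot> ((?i \<otimes> ?S) \<otimes> ?T)"
    using assoc_nat_ar[of ?i ?S ?T] by simp
  finally show ?case
    by simp
qed

end

section \<open>Alignments on lists of variables\<close>

lemma pi_list_concat: "pi_list \<pi> (concat Xss) = concat (map (pi_list \<pi>) Xss)"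
  by (induction Xss) (simp_all add: pi_list_def)

lemma set_pi_list: "set (pi_list \<pi> Xs) = (\<Union>X \<in> set Xs. set (\<pi> X))"
  by (simp add: pi_list_def)

lemma concat_map_pi: "concat (map (\<lambda>X. map ob (\<pi> X)) Xs) = map ob (pi_list \<pi> Xs)"
  by (simp add: pi_list_def map_concat comp_def)

text \<open>Needed for low-level queries to be well formed: \<open>CFc\<close> requires their lists
  of variables to be free of repetition.\<close>

lemma distinct_pi_list:
  assumes "distinct Xs" "\<And>X. X \<in> set Xs \<Longrightarrow> distinct (\<pi> X)"
    and "\<And>X X'. X \<in> set Xs \<Longrightarrow> X' \<in> set Xs \<Longrightarrow> X \<noteq> X' \<Longrightarrow> set (\<pi> X) \<inter> set (\<pi> X') = {}"
  shows "distinct (pi_list \<pi> Xs)"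
  using assms
proof (induction Xs)
  case (Cons X Xs)
  have "set (\<pi> X) \<inter> (\<Union>X' \<in> set Xs. set (\<pi> X')) = {}"
    using Cons.prems by fastforce
  moreover have "distinct (pi_list \<pi> Xs)"
    using Cons by simp
  ultimately show ?case
    using Cons.prems(2) by (simp add: pi_list_def)
qed (simp add: pi_list_def)

context monoidal_category
begin

lemma tau_list_typing:
  assumes "\<And>X. X \<in> set Xs \<Longrightarrow> \<tau> X \<in> hom C (tens C (map obL (\<pi> X))) (obH X)"
    and "\<And>X. X \<in> set Xs \<Longrightarrow> obL ` set (\<pi> X) \<subseteq> Ob C"
  shows "tau_list C obL \<pi> \<tau> Xs \<in> hom C (tens C (map obL (pi_list \<pi> Xs))) (tens C (map obH Xs))"
proof -
  have "set (map \<tau> Xs) \<subseteq> Ar C" "map (Dom C) (map \<tau> Xs) = map (tens C) (map (\<lambda>X. map obL (\<pi> X)) Xs)"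
      "map (Cod C) (map \<tau> Xs) = map obH Xs" "\<Union> (set ` set (map (\<lambda>X. map obL (\<pi> X)) Xs)) \<subseteq> Ob C"
    using assms by (auto simp: hom_iff)
  then show ?thesis
    unfolding tau_list_def hom_iff by (simp only: comp_typing mtens_typing splits_typing concat_map_pi simp_thms)
qed

text \<open>\<open>splits_append\<close> starts the blockwise splitting with a cut between the two
  lists, and \<open>mtens_append_join\<close> carries the reassembly of the blocks past the channels
  \<open>\<tau>\<close>, from their domains to their codomains.\<close>

lemma tau_list_append:
  assumes "\<And>X. X \<in> set Xs \<union> set Ys \<Longrightarrow> \<tau> X \<in> hom C (tens C (map obL (\<pi> X))) (obH X)"
    and "\<And>X. X \<in> set Xs \<union> set Ys \<Longrightarrow> obL ` set (\<pi> X) \<subseteq> Ob C"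
  shows "tau_list C obL \<pi> \<tau> (Xs @ Ys)
    = join C (map obH Xs) (map obH Ys) \<cdot> (tau_list C obL \<pi> \<tau> Xs \<otimes> tau_list C obL \<pi> \<tau> Ys)
      \<cdot> split C (map obL (pi_list \<pi> Xs)) (map obL (pi_list \<pi> Ys))"
proof -
  define b where "b = (\<lambda>X. map obL (\<pi> X))"
  let ?bX = "map b Xs" and ?bY = "map b Ys"
  let ?mX = "mtens C (map \<tau> Xs)" and ?mY = "mtens C (map \<tau> Ys)"
  let ?J = "join C (map (tens C) ?bX) (map (tens C) ?bY)" and ?K = "join C (map obH Xs) (map obH Ys)"
  let ?S = "split C (concat ?bX) (concat ?bY)"
  have ar: "set (map \<tau> Xs) \<subseteq> Ar C" "set (map \<tau> Ys) \<subseteq> Ar C"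
    and doms: "map (Dom C) (map \<tau> Xs) = map (tens C) ?bX" "map (Dom C) (map \<tau> Ys) = map (tens C) ?bY"
    and cods: "map (Cod C) (map \<tau> Xs) = map obH Xs" "map (Cod C) (map \<tau> Ys) = map obH Ys"
    and bob: "\<Union> (set ` set ?bX) \<subseteq> Ob C" "\<Union> (set ` set ?bY) \<subseteq> Ob C"
    using assms by (auto simp: hom_iff b_def)
  have cbob: "set (concat ?bX) \<subseteq> Ob C" "set (concat ?bY) \<subseteq> Ob C"
    using bob by auto
  have tob: "set (map (tens C) ?bX) \<subseteq> Ob C" "set (map (tens C) ?bY) \<subseteq> Ob C"
    using bob by (auto intro!: tens_ob)
  have hob: "set (map obH Xs) \<subseteq> Ob C" "set (map obH Ys) \<subseteq> Ob C"
    using hom_cod_ob[OF assms(1)] by auto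
  note ty = mtens_typing[OF ar(1)] mtens_typing[OF ar(2)] splits_typing[OF bob(1)] splits_typing[OF bob(2)]
    join_typing[OF tob] join_typing[OF hob] split_typing[OF cbob]
  have "tau_list C obL \<pi> \<tau> (Xs @ Ys) = mtens C (map \<tau> Xs @ map \<tau> Ys) \<cdot> splits C (?bX @ ?bY)"
    by (simp add: tau_list_def b_def)
  also have "\<dots> = mtens C (map \<tau> Xs @ map \<tau> Ys) \<cdot> ?J \<cdot> (splits C ?bX \<otimes> splits C ?bY) \<cdot> ?S"
    unfolding splits_append[OF bob] ..
  also have "\<dots> = (mtens C (map \<tau> Xs @ map \<tau> Ys) \<cdot> ?J) \<cdot> (splits C ?bX \<otimes> splits C ?bY) \<cdot> ?S"
  proof -
    have "set (map \<tau> Xs @ map \<tau> Ys) \<subseteq> Ar C"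
      using ar by simp
    note ty' = mtens_typing[OF this]
    show ?thesis
      by (rule comp_assoc_ar[symmetric])
        (simp_all only: comp_typing tensor_typing ty ty' doms map_append)
  qed
  also have "mtens C (map \<tau> Xs @ map \<tau> Ys) \<cdot> ?J = ?K \<cdot> (?mX \<otimes> ?mY)"
    using mtens_append_join[OF ar] unfolding doms cods .
  also have "(?K \<cdot> (?mX \<otimes> ?mY)) \<cdot> (splits C ?bX \<otimes> splits C ?bY) \<cdot> ?S
      = ?K \<cdot> ((?mX \<cdot> splits C ?bX) \<otimes> (?mY \<cdot> splits C ?bY)) \<cdot> ?S"
    by (simp only: comp_assoc_ar comp_typing tensor_typing tensor_merge_comp ty doms cods simp_thms)
  finally show ?thesis
    by (simp add: tau_list_def b_def concat_map_pi)
qed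

text \<open>
  An upward abstraction uses the tensor over a concatenated list of outputs, consistency the tensor of
  the blocks; the two agree only up to coherence isomorphisms.
\<close>

lemma tau_list_concat:
  assumes "\<And>X. X \<in> set (concat Ys) \<Longrightarrow> \<tau> X \<in> hom C (tens C (map (eob L) (\<pi> X))) (eob H X)"
    and "\<And>X. X \<in> set (concat Ys) \<Longrightarrow> eob L ` set (\<pi> X) \<subseteq> Ob C"
  shows "tau_list C (eob L) \<pi> \<tau> (concat Ys) = tau_blocks C L H \<pi> \<tau> Ys"
  using assms
proof (induction Ys)
  case Nil
  then show ?case by (simp add: tau_list_def tau_blocks_def)
next
  case (Cons Y Ys)
  define t where "t = tau_list C (eob L) \<pi> \<tau>"
  let ?p = "\<lambda>Y. map (eob L) (pi_list \<pi> Y)" and ?h = "map (eob H)"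
  let ?js = "joins C (map ?h Ys)" and ?ms = "mtens C (map t Ys)" and ?ss = "splits C (map ?p Ys)"
  have t: "t Z \<in> hom C (tens C (?p Z)) (tens C (?h Z))" if "Z \<in> set (Y # Ys)" for Z
    unfolding t_def by (rule tau_list_typing) (use Cons.prems that in auto)
  have ar: "set (map t Ys) \<subseteq> Ar C"
    and doms: "map (Dom C) (map t Ys) = map (tens C) (map ?p Ys)"
    and cods: "map (Cod C) (map t Ys) = map (tens C) (map ?h Ys)"
    and tY: "t Y \<in> Ar C" "Dom C (t Y) = tens C (?p Y)" "Cod C (t Y) = tens C (?h Y)"
    using t by (auto simp: hom_iff)
  have pob: "set (?p Y) \<subseteq> Ob C" "\<Union> (set ` set (map ?p Ys)) \<subseteq> Ob C"
    using Cons.prems(2) by (fastforce simp: set_pi_list)+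
  have hob: "set (?h Y) \<subseteq> Ob C" "\<Union> (set ` set (map ?h Ys)) \<subseteq> Ob C"
    using hom_cod_ob[OF Cons.prems(1)] by auto
  have hob': "set (concat (map ?h Ys)) \<subseteq> Ob C" and pob': "set (concat (map ?p Ys)) \<subseteq> Ob C"
    using hob pob by auto
  note ty = mtens_typing[OF ar] splits_typing[OF pob(2)] joins_typing[OF hob(2)] tY tens_ob[OF pob(1)]
    tens_ob[OF hob(1)] join_typing[OF hob(1) hob'] split_typing[OF pob(1) pob']
  have "t (concat (Y # Ys)) = join C (?h Y) (?h (concat Ys)) \<cdot> (t Y \<otimes> t (concat Ys))
      \<cdot> split C (?p Y) (?p (concat Ys))"
    using tau_list_append[of Y "concat Ys" \<tau> "eob L" \<pi> "eob H"] Cons.prems unfolding t_def by simp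
  also have "t (concat Ys) = ?js \<cdot> ?ms \<cdot> ?ss"
    using Cons unfolding t_def tau_blocks_def by simp
  also have "?h (concat Ys) = concat (map ?h Ys)"
    by (rule map_concat)
  also have "?p (concat Ys) = concat (map ?p Ys)"
    by (simp add: pi_list_concat map_concat comp_def)
  \<comment> \<open>Unfolding one step of \<open>joins\<close> and \<open>splits\<close> puts
    identities on the head block beside \<open>?js\<close> and \<open>?ss\<close>; merging the
    tensors absorbs them into \<open>t Y\<close>.\<close>
  also have "join C (?h Y) (concat (map ?h Ys)) \<cdot> (t Y \<otimes> (?js \<cdot> ?ms \<cdot> ?ss)) \<cdot> split C (?p Y) (concat (map ?p Ys))
      = joins C (map ?h (Y # Ys)) \<cdot> mtens C (map t (Y # Ys)) \<cdot> splits C (map ?p (Y # Ys))"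
    by (simp only: list.map joins.simps mtens.simps splits.simps comp_assoc_ar comp_typing tensor_typing
        tensor_merge_comp comp_ident_left comp_ident_right ident_typing ty doms cods simp_thms)
  finally show ?case
    unfolding t_def tau_blocks_def .
qed

end

section \<open>Typing of copies, marginals and wirings\<close>

lemma (in symmetric_monoidal_category) swap_typing [simp]:
  assumes "a \<in> Ob C" "b \<in> Ob C"
  shows "Swap C a b \<in> Ar C" "Dom C (Swap C a b) = a \<oplus> b" "Cod C (Swap C a b) = b \<oplus> a"
  using swap_hom[OF assms] by (auto simp: hom_iff)

lemma (in symmetric_monoidal_category) interchange_typing [simp]:
  assumes "a \<in> Ob C" "b \<in> Ob C" "c \<in> Ob C" "d \<in> Ob C"
  shows "interchange C a b c d \<in> Ar C" "Dom C (interchange C a b c d) = (a \<oplus> b) \<oplus> (c \<oplus> d)"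
    "Cod C (interchange C a b c d) = (a \<oplus> c) \<oplus> (b \<oplus> d)"
  using assms unfolding interchange_def by simp_all

lemma (in symmetric_monoidal_category) distribute_typing [simp]:
  assumes "u \<in> Ob C" "set as \<subseteq> Ob C"
  shows "distribute C u as \<in> Ar C"
    "Dom C (distribute C u as) = tens C (replicate (length as) u) \<oplus> tens C as"
    "Cod C (distribute C u as) = tens C (map (\<lambda>a. u \<oplus> a) as)"
proof -
  have "distribute C u as \<in> Ar C \<and>
      Dom C (distribute C u as) = tens C (replicate (length as) u) \<oplus> tens C as \<and>
      Cod C (distribute C u as) = tens C (map (\<lambda>a. u \<oplus> a) as)"
    using assms(2)
  proof (induction as)
    case (Cons a as)
    have "tens C (replicate (length as) u) \<in> Ob C"
      using assms(1) by (intro tens_ob) auto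
    with Cons assms(1) show ?case by simp
  qed simp
  then show "distribute C u as \<in> Ar C"
    "Dom C (distribute C u as) = tens C (replicate (length as) u) \<oplus> tens C as"
    "Cod C (distribute C u as) = tens C (map (\<lambda>a. u \<oplus> a) as)"
    by auto
qed

context markov_category
begin

lemma copy_del_typing [simp]:
  assumes "a \<in> Ob C"
  shows "Copy C a \<in> Ar C" "Dom C (Copy C a) = a" "Cod C (Copy C a) = a \<oplus> a"
    "Del C a \<in> Ar C" "Dom C (Del C a) = a" "Cod C (Del C a) = Unit C"
  using copy_hom[OF assms] del_hom[OF assms] by (auto simp: hom_iff)

lemma mcopy_typing [simp]:
  assumes "a \<in> Ob C"
  shows "mcopy C a m \<in> Ar C" "Dom C (mcopy C a m) = a" "Cod C (mcopy C a m) = tens C (replicate m a)"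
  using assms by (induction m) auto

lemma state_tens_typing [simp]:
  assumes "\<And>x. x \<in> set xs \<Longrightarrow> x \<in> Ar C \<and> Dom C x = Unit C"
  shows "state_tens C xs \<in> Ar C" "Dom C (state_tens C xs) = Unit C"
    "Cod C (state_tens C xs) = tens C (map (Cod C) xs)"
  using assms by (induction xs) auto

text \<open>Membership of \<open>y\<close> excludes the empty list, at which \<open>marg\<close> is
  \<open>undefined\<close>.\<close>

lemma marg_typing:
  assumes "ob ` set zs \<subseteq> Ob C" "y \<in> set zs"
  shows "marg C ob zs y \<in> hom C (tens C (map ob zs)) (ob y)"
  using assms by (induction zs) (auto simp: hom_iff)

lemma select_typing:
  assumes "ob ` set zs \<subseteq> Ob C" "set ys \<subseteq> set zs"
  shows "select C ob zs ys \<in> hom C (tens C (map ob zs)) (tens C (map ob ys))"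
  using assms(2)
proof (induction ys)
  case Nil
  then show ?case using assms(1) by (simp add: hom_iff)
next
  case (Cons y ys)
  then show ?case
    using marg_typing[OF assms(1), of y] assms(1) by (simp add: hom_iff)
qed

lemma fcm_typing:
  assumes "functional_causal_model C M" "v \<in> vars M"
  shows "eob M v \<in> Ob C" "vob M (Exo v) \<in> Ob C" "lam M v \<in> hom C (Unit C) (vob M (Exo v))"
    "mech M v \<in> hom C (tens C (map (eob M) (pa M v)) \<oplus> vob M (Exo v)) (eob M v)" "set (pa M v) \<subseteq> vars M"
  using assms unfolding functional_causal_model_def by auto

lemma add_var_typing:
  assumes M: "functional_causal_model C M" and v: "v \<in> vars M" and zs: "vob M ` set zs \<subseteq> Ob C"
    and "Exo v \<in> set zs" "Endo ` set (pa M v) \<subseteq> set zs"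
  shows "add_var C M zs v \<in> hom C (tens C (map (vob M) zs)) (tens C (map (vob M) (Endo v # zs)))"
proof -
  have "select C (vob M) zs (map Endo (pa M v))
      \<in> hom C (tens C (map (vob M) zs)) (tens C (map (vob M) (map Endo (pa M v))))"
    by (rule select_typing) (use assms in auto)
  moreover have "marg C (vob M) zs (Exo v) \<in> hom C (tens C (map (vob M) zs)) (vob M (Exo v))"
    by (rule marg_typing) (use assms in auto)
  ultimately show ?thesis
    using fcm_typing[OF M v] zs by (simp add: add_var_def hom_iff Let_def comp_def)
qed

text \<open>The assumption on decompositions of \<open>vs\<close> is the invariant of wiring: each
  parent comes earlier in \<open>vs\<close> or is already a wire of \<open>zs\<close>. Adding the
  head of \<open>vs\<close> moves it from the first group to the second.\<close>

lemma wire_typing: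
  assumes M: "functional_causal_model C M" and "set vs \<subseteq> vars M" and "vob M ` set zs \<subseteq> Ob C"
    and "Exo ` set vs \<subseteq> set zs"
    and "\<And>as v bs. vs = as @ v # bs \<Longrightarrow> Endo ` set (pa M v) \<subseteq> Endo ` set as \<union> set zs"
    and "set ys \<subseteq> Endo ` set vs \<union> set zs"
  shows "wire C M vs zs ys \<in> hom C (tens C (map (vob M) zs)) (tens C (map (vob M) ys))"
  using assms(2-)
proof (induction vs arbitrary: zs)
  case Nil
  then show ?case using select_typing[of "vob M" zs ys] by simp
next
  case (Cons v vs)
  have v: "v \<in> vars M"
    using Cons.prems by simp
  have "Endo ` set (pa M v) \<subseteq> set zs"
    using Cons.prems(4)[of "[]" v vs] by simp
  then have "add_var C M zs v \<in> hom C (tens C (map (vob M) zs)) (tens C (map (vob M) (Endo v # zs)))"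
    using add_var_typing[OF M v Cons.prems(2)] Cons.prems(3) by simp
  moreover have "wire C M vs (Endo v # zs) ys
      \<in> hom C (tens C (map (vob M) (Endo v # zs))) (tens C (map (vob M) ys))"
  proof (rule Cons.IH)
    show "Endo ` set (pa M w) \<subseteq> Endo ` set as \<union> set (Endo v # zs)" if "vs = as @ w # bs" for as w bs
      using Cons.prems(4)[of "v # as" w bs] that by auto
  qed (use Cons.prems(1-3,5) fcm_typing(1)[OF M v] in auto)
  ultimately show ?case
    unfolding wire.simps by (rule comp_hom)
qed

end

section \<open>Topological orders of a causal model\<close>

text \<open>Finiteness and acyclicity make the parent relation well-founded, so an order can be
  built by repeatedly appending a minimal remaining variable.\<close>

lemma ex_topological:
  assumes "functional_causal_model C M"
  shows "\<exists>vs. topological M vs"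
proof -
  let ?r = "{(p, v). v \<in> vars M \<and> p \<in> set (pa M v)}"
  have pa: "set (pa M v) \<subseteq> vars M" if "v \<in> vars M" for v
    using assms that by (auto simp: functional_causal_model_def)
  have "?r \<subseteq> vars M \<times> vars M"
    using pa by auto
  then have fin: "finite ?r"
    by (rule finite_subset) simp
  \<comment> \<open>A cycle among endogenous names lifts along \<open>Endo\<close> to a cycle of
    \<open>edges M\<close>.\<close>
  have "(Endo a, Endo b) \<in> (edges M)\<^sup>+" if "(a, b) \<in> ?r\<^sup>+" for a b
    using that
  proof (induction rule: trancl_induct)
    case (base b)
    then show ?case by (auto simp: edges_def)
  next
    case (step b c)
    then have "(Endo b, Endo c) \<in> edges M" by (auto simp: edges_def)
    with step.IH show ?case by (rule trancl_into_trancl)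
  qed
  moreover have "acyclic (edges M)"
    using assms by (simp add: functional_causal_model_def)
  ultimately have "acyclic ?r"
    unfolding acyclic_def by blast
  with fin have wf: "wf ?r"
    by (rule finite_acyclic_wf)
  let ?ok = "\<lambda>vs. distinct vs \<and> set vs \<subseteq> vars M \<and> (\<forall>as v bs. vs = as @ v # bs \<longrightarrow> set (pa M v) \<subseteq> set as)"
  \<comment> \<open>Initial segments closed under parents exist in every length up to the number of
    variables; at full length the segment exhausts \<open>vars M\<close>.\<close>
  have "\<exists>vs. ?ok vs \<and> length vs = n" if "n \<le> card (vars M)" for n
    using that
  proof (induction n)
    case 0
    show ?case by (intro exI[of _ "[]"]) simp
  next
    case (Suc n)
    obtain vs where vs: "?ok vs" "length vs = n"
      using Suc.IH[OF Suc_leD[OF Suc.prems]] by blast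
    have "card (set vs) < card (vars M)"
      using vs(2) distinct_card[OF conjunct1[OF vs(1)]] Suc.prems by linarith
    then obtain v0 where "v0 \<in> vars M - set vs"
      by (metis Diff_iff List.finite_set card_mono not_less subsetI)
    \<comment> \<open>Minimality of \<open>v\<close> among the variables left puts all its parents
      into \<open>vs\<close>.\<close>
    then obtain v where v: "v \<in> vars M - set vs" and min: "\<And>w. (w, v) \<in> ?r \<Longrightarrow> w \<notin> vars M - set vs"
      using wfE_min[OF wf, of v0 "vars M - set vs"] by blast
    have "set (pa M v) \<subseteq> set vs"
      using v min pa by blast
    then have "set (pa M w) \<subseteq> set as" if "vs @ [v] = as @ w # bs" for as w bs
    \<comment> \<open>If \<open>bs\<close> is empty, \<open>w\<close> is the new variable
      \<open>v\<close>; otherwise dropping the last entry leaves a decomposition of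
      \<open>vs\<close>.\<close>
    proof (cases bs rule: rev_cases)
      case Nil
      with that \<open>set (pa M v) \<subseteq> set vs\<close> show ?thesis by simp
    next
      case (snoc cs c)
      with that have "vs = as @ w # cs" by simp
      with vs(1) show ?thesis by blast
    qed
    moreover have "distinct (vs @ [v])" "set (vs @ [v]) \<subseteq> vars M"
      using v vs(1) by simp_all
    ultimately have "?ok (vs @ [v])"
      by blast
    moreover have "length (vs @ [v]) = Suc n"
      using vs(2) by simp
    ultimately show ?case by blast
  qed
  from this[OF order_refl] obtain vs where vs: "?ok vs" "length vs = card (vars M)" by blast
  then have "set vs = vars M"
    by (intro card_subset_eq) (simp_all add: distinct_card)
  with vs(1) show ?thesis
    unfolding topological_def by blast
qed

lemma topological_topo_order: "functional_causal_model C M \<Longrightarrow> topological M (topo_order M)"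
  unfolding topo_order_def using ex_topological by (rule someI_ex)

section \<open>Typing of counterfactual states\<close>

context markov_category
begin

text \<open>A parent of a variable outside \<open>X\<close> either lies in \<open>X\<close>, and is
  then an input wire, or survives the filter and still comes earlier in the order, as
  \<open>wire_typing\<close> demands.\<close>

lemma F_Do_typing:
  assumes M: "functional_causal_model C M" and X: "set X \<subseteq> vars M" and Y: "set Y \<subseteq> vars M"
  shows "F_Do C M X Y \<in> hom C (exo_ob C M \<oplus> tens C (map (eob M) X)) (tens C (map (eob M) Y))"
proof -
  let ?zs = "map Exo (endo M) @ map Endo X" and ?vs = "filter (\<lambda>v. v \<notin> set X) (topo_order M)"
  have top: "set (topo_order M) = vars M"
      "\<And>as v bs. topo_order M = as @ v # bs \<Longrightarrow> set (pa M v) \<subseteq> set as"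
    using topological_topo_order[OF M] by (auto simp: topological_def)
  have "wire C M ?vs ?zs (map Endo Y)
      \<in> hom C (tens C (map (vob M) ?zs)) (tens C (map (vob M) (map Endo Y)))"
  proof (rule wire_typing[OF M])
    show "Endo ` set (pa M v) \<subseteq> Endo ` set as \<union> set ?zs" if vs: "?vs = as @ v # bs" for as v bs
    proof -
      have v: "v \<in> set (topo_order M)" "v \<notin> set X"
        using arg_cong[OF vs, of set] by auto
      then obtain us ws where order: "topo_order M = us @ v # ws"
        by (meson split_list)
      then have "v \<notin> set us" "v \<notin> set ws"
        using topological_topo_order[OF M] by (auto simp: topological_def)
      \<comment> \<open>A topological order lists \<open>v\<close> only once, so what precedes
        \<open>v\<close> in the filtered list is the filtered part of the order before
        \<open>v\<close>.\<close>
      then have as: "as = filter (\<lambda>v. v \<notin> set X) us"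
        using vs order v(2) append_Cons_eq_iff[of v "filter (\<lambda>v. v \<notin> set X) us"] by simp
      have "set (pa M v) \<subseteq> set us"
        using top(2) order by blast
      then show ?thesis
        unfolding as by auto
    qed
  qed (use top X Y fcm_typing(1,2)[OF M] in auto)
  moreover have "set (map (\<lambda>v. vob M (Exo v)) (endo M)) \<subseteq> Ob C" "set (map (eob M) X) \<subseteq> Ob C"
    using X fcm_typing(1,2)[OF M] by auto
  then have "join C (map (\<lambda>v. vob M (Exo v)) (endo M)) (map (eob M) X)
      \<in> hom C (exo_ob C M \<oplus> tens C (map (eob M) X)) (tens C (map (vob M) ?zs))"
    unfolding hom_iff exo_ob_def by (simp add: comp_def)
  ultimately show ?thesis
    unfolding F_Do_def by (auto intro: comp_hom simp: comp_def)
qed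

lemma exo_typing:
  assumes M: "functional_causal_model C M"
  shows "exo_ob C M \<in> Ob C" "exo_state C M \<in> hom C (Unit C) (exo_ob C M)"
proof -
  show "exo_ob C M \<in> Ob C"
    using fcm_typing(2)[OF M] by (auto simp: exo_ob_def intro!: tens_ob)
  have "map (Cod C) (map (lam M) (endo M)) = map (\<lambda>v. vob M (Exo v)) (endo M)"
    using fcm_typing(3)[OF M] by (auto simp: hom_iff)
  then show "exo_state C M \<in> hom C (Unit C) (exo_ob C M)"
    using state_tens_typing[of "map (lam M) (endo M)"] fcm_typing(3)[OF M]
    unfolding exo_ob_def exo_state_def hom_iff by (auto simp del: map_map)
qed

text \<open>The factors of \<open>cf_sem\<close> compose because their objects agree listwise:
  \<open>Fs\<close> matches the inputs of the channels with the output of \<open>distribute\<close>,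
  and \<open>xs(2)\<close> matches the sharp states with the intervened variables.\<close>

lemma cf_sem_typing:
  assumes M: "functional_causal_model C M" and q: "q \<in> CFc C (vars M) (eob M)"
  shows "cf_sem C M q \<in> hom C (Unit C) (tens C (map (eob M) (concat (map (\<lambda>(X, x, Y). Y) q))))"
proof -
  let ?Fs = "map (\<lambda>(X, x, Y). F_Do C M X Y) q"
  let ?as = "map (\<lambda>(X, x, Y). tens C (map (eob M) X)) q"
  let ?xs = "map (\<lambda>(X, x, Y). x) q"
  let ?bss = "map (\<lambda>(X, x, Y). map (eob M) Y) q"
  have mem: "set X \<subseteq> vars M" "set Y \<subseteq> vars M" "x \<in> hom C (Unit C) (tens C (map (eob M) X))"
    if "(X, x, Y) \<in> set q" for X x Y
    using q that by (auto simp: CFc_def sharp_state_def)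
  have F: "F_Do C M X Y \<in> hom C (exo_ob C M \<oplus> tens C (map (eob M) X)) (tens C (map (eob M) Y))"
    if "(X, x, Y) \<in> set q" for X x Y
    using F_Do_typing[OF M] mem[OF that] by blast
  have Fs: "set ?Fs \<subseteq> Ar C" "map (Dom C) ?Fs = map (\<lambda>a. exo_ob C M \<oplus> a) ?as"
      "map (Cod C) ?Fs = map (tens C) ?bss"
    using F by (auto simp: hom_iff)
  have as: "set ?as \<subseteq> Ob C"
    using hom_cod_ob[OF mem(3)] by auto
  have bss: "\<Union> (set ` set ?bss) \<subseteq> Ob C"
    using mem(2) fcm_typing(1)[OF M] by fastforce
  have xs: "\<And>x. x \<in> set ?xs \<Longrightarrow> x \<in> Ar C \<and> Dom C x = Unit C" "map (Cod C) ?xs = ?as"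
    using mem(3) by (auto simp: hom_iff)
  have exo: "exo_state C M \<in> Ar C" "Dom C (exo_state C M) = Unit C" "Cod C (exo_state C M) = exo_ob C M"
    using exo_typing(2)[OF M] by (auto simp: hom_iff)
  have cod: "concat ?bss = map (eob M) (concat (map (\<lambda>(X, x, Y). Y) q))"
    by (simp add: map_concat comp_def case_prod_unfold)
  show ?thesis
    unfolding cf_sem_def hom_iff cod[symmetric]
    by (simp only: comp_typing tensor_typing mtens_typing[OF Fs(1)] Fs(2,3) joins_typing[OF bss]
        distribute_typing[OF exo_typing(1)[OF M] as] mcopy_typing[OF exo_typing(1)[OF M]]
        state_tens_typing[OF xs(1)] xs(2) exo unitor_typing unit_ob length_map simp_thms)
qed

end

section \<open>Signatures of counterfactual queries and the equivalence\<close>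

lemma wf_cf_signature: "R \<subseteq> CFc C V ob \<Longrightarrow> wf_signature (cf_signature V R)"
  by (fastforce simp: wf_signature_def cf_signature_def CFc_def)

text \<open>The last two assumptions turn the prescription for \<open>\<omega>\<close> into a
  partial surjection: every query of \<open>Q\<close> comes from aligned data, and these data can be
  recovered from the low query. On the right-hand side \<open>\<omega>\<close> is pinned down by its
  graph.\<close>

theorem corollary38:
  fixes C :: "('o, 'm) markov_cat"
    and L :: "('l, 'o, 'm) fcm" and H :: "('h, 'o, 'm) fcm"
    and \<pi> :: "'h \<Rightarrow> 'l list" and \<tau> :: "'h \<Rightarrow> 'm"
    and Q :: "('h, 'm) cf_query set"
  assumes "markov_category C"
    and "functional_causal_model C L" and "functional_causal_model C H"
    and "variable_alignment C L H \<pi> \<tau>"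
    and "Q \<subseteq> CFc C (vars H) (eob H)"
    and "Q \<subseteq> high_query C L \<pi> \<tau> ` aligned_data C L H \<pi>"
    and "inj_on (pi_list \<pi>) (occurring Q)"
  shows "consistent C L H \<pi> \<tau> Q \<longleftrightarrow>
    (\<exists>\<omega>. (\<forall>p q. \<omega> p = Some q \<longleftrightarrow>
            (\<exists>d \<in> aligned_data C L H \<pi>. high_query C L \<pi> \<tau> d \<in> Q \<and>
               p = low_query \<pi> d \<and> q = high_query C L \<pi> \<tau> d)) \<and>
         upward_abstraction C
           (cf_signature (vars L) (CFc C (vars L) (eob L))) (cf_model C L)
           (cf_signature (vars H) Q) (cf_model C H) \<pi> \<tau> \<omega>)"
proof -
  interpret markov_category C by fact
  note L = assms(2) and H = assms(3) and align = assms(4) and QCF = assms(5)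
  let ?D = "aligned_data C L H \<pi>" and ?low = "low_query \<pi>" and ?high = "high_query C L \<pi> \<tau>"
  let ?SL = "cf_signature (vars L) (CFc C (vars L) (eob L))" and ?SH = "cf_signature (vars H) Q"
  let ?t = "tau_list C (eob L) \<pi> \<tau>"
  let ?outs = "\<lambda>d. map (\<lambda>(X, x, Y). Y) d"
  have \<tau>: "\<tau> X \<in> hom C (tens C (map (eob L) (\<pi> X))) (eob H X)" "eob L ` set (\<pi> X) \<subseteq> Ob C"
    if "X \<in> vars H" for X
    using align that fcm_typing(1)[OF L] by (auto simp: variable_alignment_def)
  \<comment> \<open>Low queries belong to the source signature because the blocks of an alignment
    are disjoint and without repetition; this bounds the domain of \<open>\<omega>\<close>.\<close>
  have low: "?low d \<in> CFc C (vars L) (eob L)" if "d \<in> ?D" for d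
  proof -
    have "distinct (pi_list \<pi> Z) \<and> set (pi_list \<pi> Z) \<subseteq> vars L" if "distinct Z" "set Z \<subseteq> vars H" for Z
      using align that unfolding variable_alignment_def set_pi_list
      by (intro conjI distinct_pi_list) (blast | auto)+
    then show ?thesis
      using that by (fastforce simp: aligned_data_def low_query_def CFc_def)
  qed
  have outs_high: "?outs (?high d) = ?outs d" for d
    by (simp add: high_query_def case_prod_unfold comp_def)
  have outs_low: "concat (?outs (?low d)) = pi_list \<pi> (concat (?outs d))"
    for d :: "('h list \<times> 'm \<times> 'h list) list"
    by (simp add: low_query_def case_prod_unfold comp_def pi_list_concat)
  \<comment> \<open>Queries have no inputs, so \<open>?t []\<close> is an identity of the unit
    object, and \<open>tau_list_concat\<close> turns the remaining equation into the consistency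
    equation.\<close>
  have commutes: "?t (concat (?outs d)) \<cdot>\<^bsub>C\<^esub> cf_sem C L (?low d) = cf_sem C H (?high d) \<cdot>\<^bsub>C\<^esub> ?t []
      \<longleftrightarrow> tau_blocks C L H \<pi> \<tau> (?outs d) \<cdot>\<^bsub>C\<^esub> cf_sem C L (?low d) = cf_sem C H (?high d)"
    if "d \<in> ?D" "?high d \<in> Q" for d
  proof -
    have "set (concat (?outs d)) \<subseteq> vars H"
      using that(1) by (fastforce simp: aligned_data_def)
    then have "?t (concat (?outs d)) = tau_blocks C L H \<pi> \<tau> (?outs d)"
      by (intro tau_list_concat) (use \<tau> in blast)+
    moreover have "cf_sem C H (?high d) \<cdot>\<^bsub>C\<^esub> ?t [] = cf_sem C H (?high d)"
      using cf_sem_typing[OF H] that(2) QCF by (auto simp: tau_list_def hom_iff)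
    ultimately show ?thesis by simp
  qed
  have occurring: "X \<in> occurring Q" "Y \<in> occurring Q"
    if "?high d \<in> Q" "(X, x, Y) \<in> set d" for d X x Y
  proof -
    have "(X, ?t X \<cdot>\<^bsub>C\<^esub> x, Y) \<in> set (?high d)"
      using that(2) by (force simp: high_query_def)
    with that(1) show "X \<in> occurring Q" "Y \<in> occurring Q"
      unfolding occurring_def by blast+
  qed
  \<comment> \<open>\<open>?low\<close> keeps the sharp states and applies \<open>pi_list\<close> to
    the variable lists, which is injective on those occurring in \<open>Q\<close>; the data are
    compared entry by entry.\<close>
  have low_inj: "d = d'" if "?high d \<in> Q" "?high d' \<in> Q" "?low d = ?low d'" for d d'
  proof (rule nth_equalityI)
    show len: "length d = length d'"
      using arg_cong[OF that(3), of length] by (simp add: low_query_def)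
    fix i assume i: "i < length d"
    obtain X x Y where di: "d ! i = (X, x, Y)"
      by (rule prod_cases3)
    obtain X' x' Y' where di': "d' ! i = (X', x', Y')"
      by (rule prod_cases3)
    have "?low d ! i = ?low d' ! i"
      by (rule arg_cong[OF that(3)])
    then have eq: "pi_list \<pi> X = pi_list \<pi> X'" "x = x'" "pi_list \<pi> Y = pi_list \<pi> Y'"
      using i len di di' by (simp_all add: low_query_def)
    have "X \<in> occurring Q" "Y \<in> occurring Q"
      using occurring[OF that(1)] nth_mem[OF i] di by simp_all
    moreover have "X' \<in> occurring Q" "Y' \<in> occurring Q"
      using occurring[OF that(2)] nth_mem[of i d'] i len di' by simp_all
    ultimately show "d ! i = d' ! i"
      using eq di di' inj_onD[OF assms(7)] by metis
  qed
  \<comment> \<open>By \<open>low_inj\<close> the choice is of the only possible datum;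
    \<open>None\<close> elsewhere makes the graph of \<open>\<omega>\<close> exactly the prescribed
    one.\<close>
  define \<omega> where "\<omega> p = (if \<exists>d \<in> ?D. ?high d \<in> Q \<and> p = ?low d
    then Some (?high (SOME d. d \<in> ?D \<and> ?high d \<in> Q \<and> p = ?low d)) else None)" for p
  have \<omega>: "\<omega> p = Some q \<longleftrightarrow> (\<exists>d \<in> ?D. ?high d \<in> Q \<and> p = ?low d \<and> q = ?high d)" for p q
  proof (cases "\<exists>d \<in> ?D. ?high d \<in> Q \<and> p = ?low d")
    case True
    then obtain d where d: "d \<in> ?D \<and> ?high d \<in> Q \<and> p = ?low d" by blast
    then have "(SOME d. d \<in> ?D \<and> ?high d \<in> Q \<and> p = ?low d) = d"
      by (rule some_equality) (use d low_inj in blast)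
    then have "\<omega> p = Some (?high d)"
      using True by (simp add: \<omega>_def)
    moreover have "d' = d" if "?high d' \<in> Q" "p = ?low d'" for d'
      using low_inj[OF that(1)] d that(2) by simp
    ultimately show ?thesis
      using d by auto
  next
    case False
    then show ?thesis by (auto simp: \<omega>_def)
  qed
  \<comment> \<open>Stated over an arbitrary type of variables, as it is applied both to
    \<open>L\<close> with all its queries and to \<open>H\<close> with \<open>Q\<close>.\<close>
  have models: "models C (cf_signature (vars M) R) (cf_model C M)"
    if "functional_causal_model C M" "R \<subseteq> CFc C (vars M) (eob M)" for M :: "('v, 'o, 'm) fcm" and R
    using that fcm_typing(1)[OF that(1)] cf_sem_typing[OF that(1)]
    by (auto simp: models_def cf_signature_def cf_model_def)
  \<comment> \<open>Only the graph of \<open>\<omega>'\<close> is fixed here, so the same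
    equivalence serves for the \<open>\<omega>\<close> constructed above and for any witness of the
    right-hand side.\<close>
  have abstraction: "upward_abstraction C ?SL (cf_model C L) ?SH (cf_model C H) \<pi> \<tau> \<omega>'
      \<longleftrightarrow> consistent C L H \<pi> \<tau> Q"
    if \<omega>': "\<And>p q. \<omega>' p = Some q \<longleftrightarrow> (\<exists>d \<in> ?D. ?high d \<in> Q \<and> p = ?low d \<and> q = ?high d)" for \<omega>'
  proof -
    have wf: "wf_signature ?SL" "wf_signature ?SH"
      using QCF by (auto intro: wf_cf_signature)
    have "dom \<omega>' \<subseteq> queries ?SL"
      using \<omega>' low by (auto simp: dom_def cf_signature_def)
    \<comment> \<open>Surjectivity: by \<open>assms(6)\<close> every query of \<open>Q\<close> is
      the high query of some aligned data.\<close>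
    moreover have "ran \<omega>' = queries ?SH"
    proof -
      have "ran \<omega>' = {q. \<exists>d \<in> ?D. ?high d \<in> Q \<and> q = ?high d}"
        unfolding ran_def \<omega>' by blast
      then show ?thesis
        using assms(6) by (auto simp: cf_signature_def)
    qed
    \<comment> \<open>A condition on the graph is a condition on the data; with the last clause of
      \<open>upward_abstraction\<close> for \<open>S\<close>, what remains is the equation treated
      in \<open>commutes\<close>.\<close>
    moreover have "(\<forall>p q. \<omega>' p = Some q \<longrightarrow> S p q) \<longleftrightarrow> (\<forall>d \<in> ?D. ?high d \<in> Q \<longrightarrow> S (?low d) (?high d))"
      for S
      unfolding \<omega>' by blast
    moreover have "pi_list \<pi> [] = []"
      by (simp add: pi_list_def)
    ultimately show ?thesis
      using wf models[OF L order_refl] models[OF H QCF] align commutes outs_high outs_low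
      unfolding upward_abstraction_def consistent_def variable_alignment_def
      by (simp add: cf_signature_def cf_model_def)
  qed
  show ?thesis (is "_ \<longleftrightarrow> (\<exists>\<omega>. ?P \<omega>)")
  proof
    assume "consistent C L H \<pi> \<tau> Q"
    with \<omega> abstraction[OF \<omega>] show "\<exists>\<omega>. ?P \<omega>"
      by (intro exI[of _ \<omega>]) blast
  next
    assume "\<exists>\<omega>. ?P \<omega>"
    then obtain \<omega>' where "?P \<omega>'" ..
    with abstraction[of \<omega>'] show "consistent C L H \<pi> \<tau> Q"
      by blast
  qed
qed

end
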